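(* For every integer $n\geq 3$, the metric dimension of the generalized Hamming graph $HG(n,n,n;3)$ is $$\dim HG(n,n,n;3)=\begin{cases} 2n & \text{if } n\in\{3,4\},\\ 2n-1 & \text{if } n\geq 5.\end{cases}$$
   Context: For positive integers $n_1,n_2,n_3$, write $[n]=\{1,2,\ldots,n\}$. The generalized Hamming graph $HG(n_1,n_2,n_3;3)$ is the simple graph with vertex set $[n_1]\times[n_2]\times[n_3]$ in which two vertices $(x_1,x_2,x_3)$ and $(y_1,y_2,y_3)$ are adjacent if and only if they differ in all three coordinates, i.e. $x_i\neq y_i$ for $i=1,2,3$. When all $n_i\geq 3$ this graph is connected (of diameter two). For a finite connected graph $G$ with vertex set $V$, let $d(x,y)$ denote the length of a shortest path between $x$ and $y$. A subset $W\subseteq V$ is a resolving set for $G$ (or $W$ resolves $G$) if for every pair of distinct vertices $x,y\in V-W$ there exists $w\in W$ such that $d(x,w)\neq d(y,w)$. The metric dimension $\dim G$ is the minimum size of a resolving set for $G$. *)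

theory Defs
  imports "Graph_Theory.Graph_Theory"
begin

text \<open>
  An undirected simple graph is represented as in \<^locale>\<open>graph\<close>: every edge is a pair of
  opposite arcs, without loops or parallel arcs.
\<close>

context pre_digraph
begin

text \<open>Meaningful only when \<open>y\<close> is reachable from \<open>x\<close>; otherwise the value is unspecified.\<close>

definition gdist :: "'a \<Rightarrow> 'a \<Rightarrow> nat" where
  "gdist x y = (LEAST k. \<exists>p. apath x p y \<and> length p = k)"

definition resolving_set :: "'a set \<Rightarrow> bool" where
  "resolving_set W \<longleftrightarrow> W \<subseteq> verts G \<and>
     (\<forall>x \<in> verts G - W. \<forall>y \<in> verts G - W. x \<noteq> y \<longrightarrow> (\<exists>w\<in>W. gdist x w \<noteq> gdist y w))"

text \<open>For a finite graph the minimum exists, because the set of all vertices is resolving.\<close>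

definition metric_dimension :: nat where
  "metric_dimension = (LEAST k. \<exists>W. resolving_set W \<and> card W = k)"

end

definition HG3 :: "nat \<Rightarrow> nat \<Rightarrow> nat \<Rightarrow> (nat \<times> nat \<times> nat) pair_pre_digraph" where
  "HG3 n1 n2 n3 = (let V = {1..n1} \<times> {1..n2} \<times> {1..n3} in
     \<lparr> pverts = V,
       parcs = {((x1, x2, x3), (y1, y2, y3)) | x1 x2 x3 y1 y2 y3.
                  (x1, x2, x3) \<in> V \<and> (y1, y2, y3) \<in> V \<and> x1 \<noteq> y1 \<and> x2 \<noteq> y2 \<and> x3 \<noteq> y3} \<rparr>)"

text \<open>
  The following facts confirm that the definitions behave as intended: \<open>gdist\<close> is the shortest
  path distance of the library for unit arc weights, and the graph is a simple graph, connected
  when all three parameters are at least 3.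
\<close>

lemma (in wf_digraph) gdist_eq_mu:
  assumes "x \<rightarrow>\<^sup>* y"
  shows "ereal (real (gdist x y)) = \<mu> (\<lambda>_. 1) x y"
proof -
  have cost: "awalk_cost (\<lambda>_. 1) p = real (length p)" for p
    by (induct p) auto
  have ex: "\<exists>p. apath x p y \<and> length p = gdist x y"
    unfolding gdist_def
    by (rule LeastI_ex) (use assms reachable_apath in blast)
  then obtain p where p: "apath x p y" "length p = gdist x y" by blast
  have le: "gdist x y \<le> length q" if q: "awalk x q y" for q
  proof -
    have "apath x (awalk_to_apath q) y" using q by (rule apath_awalk_to_apath)
    then have "gdist x y \<le> length (awalk_to_apath q)"
      unfolding gdist_def by (intro Least_le) blast
    also have "\<dots> \<le> length q"
      using q
    proof (induct rule: awalk_to_apath_induct)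
      case (path p)
      then show ?case by (auto simp: awalk_to_apath.simps)
    next
      case (decomp p q r s)
      then show ?case
        using step_awalk_to_apath[of x p y q r s] by (auto elim!: awalk_cyc_decompE)
    qed
    finally show ?thesis .
  qed
  show ?thesis unfolding \<mu>_def cost
  proof (rule INF_eqI [symmetric])
    fix q assume "q \<in> {p. awalk x p y}"
    then show "ereal (real (gdist x y)) \<le> ereal (real (length q))"
      using le by simp
  next
    fix z :: ereal
    assume "\<And>i. i \<in> {p. awalk x p y} \<Longrightarrow> z \<le> ereal (real (length i))"
    then show "z \<le> ereal (real (gdist x y))"
      using p by (metis awalkI_apath mem_Collect_eq)
  qed
qed

lemma pair_graph_HG3: "pair_graph (HG3 n1 n2 n3)"
proof
  let ?V = "{1..n1} \<times> {1..n2} \<times> {1..n3}"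
  show "finite (pverts (HG3 n1 n2 n3))" by (simp add: HG3_def)
  have "parcs (HG3 n1 n2 n3) \<subseteq> ?V \<times> ?V" by (auto simp: HG3_def)
  then show "finite (parcs (HG3 n1 n2 n3))" by (rule finite_subset) simp
  show "symmetric (HG3 n1 n2 n3)"
    by (auto simp: symmetric_def sym_def HG3_def)
qed (auto simp: HG3_def)

lemma connected_HG3:
  assumes "n1 \<ge> 3" "n2 \<ge> 3" "n3 \<ge> 3"
  shows "connected (HG3 n1 n2 n3)"
proof -
  interpret pair_graph "HG3 n1 n2 n3" by (rule pair_graph_HG3)
  have third: "\<exists>c\<in>{1..m}. c \<noteq> a \<and> c \<noteq> b" if "m \<ge> 3" for m a b :: nat
  proof -
    have "\<not> {1, 2, 3} \<subseteq> {a, b}"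
      using card_mono[of "{a, b}" "{1, 2, 3}"] card_insert_le_m1[of 2 "{b}" a] by auto
    then obtain c where "c \<in> {1, 2, 3}" "c \<notin> {a, b}" by blast
    then show ?thesis using that by (intro bexI[of _ c]) auto
  qed
  have "x \<rightarrow>\<^sup>*\<^bsub>HG3 n1 n2 n3\<^esub> y"
    if x: "x \<in> pverts (HG3 n1 n2 n3)" and y: "y \<in> pverts (HG3 n1 n2 n3)" for x y
  proof -
    obtain x1 x2 x3 y1 y2 y3 where xy: "x = (x1, x2, x3)" "y = (y1, y2, y3)"
      by (metis prod_cases3)
    obtain z1 where z1: "z1 \<in> {1..n1}" "z1 \<noteq> x1" "z1 \<noteq> y1"
      using third[OF assms(1)] by blast
    obtain z2 where z2: "z2 \<in> {1..n2}" "z2 \<noteq> x2" "z2 \<noteq> y2"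
      using third[OF assms(2)] by blast
    obtain z3 where z3: "z3 \<in> {1..n3}" "z3 \<noteq> x3" "z3 \<noteq> y3"
      using third[OF assms(3)] by blast
    have "(x, (z1, z2, z3)) \<in> parcs (HG3 n1 n2 n3)" "((z1, z2, z3), y) \<in> parcs (HG3 n1 n2 n3)"
      using x y z1 z2 z3 by (auto simp: xy HG3_def)
    then show ?thesis by (metis adj_reachable_trans reachable_adjI with_proj_simps(3))
  qed
  moreover have "pverts (HG3 n1 n2 n3) \<noteq> {}" using assms by (auto simp: HG3_def)
  ultimately show ?thesis
    by (auto simp: connected_def strongly_connected_def intro: reachable_mk_symmetricI)
qed

end

theory Submission
  imports Defs
begin

text \<open>
  A vertex outside \<open>W\<close> has distance 2 from the members of \<open>W\<close> with which it shares a coordinate and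
  distance 1 from all others. So \<open>W\<close> resolves the graph iff no two vertices outside \<open>W\<close> share
  coordinates with the same members of \<open>W\<close>. Each of the three coordinates partitions \<open>W\<close> into \<open>n\<close>
  classes, some possibly empty, and the vertex \<open>(i, j, k)\<close> is seen by \<open>W\<close> as the union of the \<open>i\<close>-th
  class of the first partition, the \<open>j\<close>-th of the second and the \<open>k\<close>-th of the third. These unions
  have to be different for different vertices; the vertices in \<open>W\<close> are exempt, and they are exactly
  the triples of classes with a common point.

  Lower bound. If two classes of one partition had at most two points altogether, then one class from
  each of the other two partitions would cover these points, and the two classes could be exchanged
  without changing the union (\<open>two_classes\<close>). So any two classes of a partition have at least three points
  together, which gives at least \<open>2 * n - 1\<close> points. In the case of equality each partition consists of
  one singleton and \<open>n - 1\<close> pairs, in other words it is the set of orbits of an involution of \<open>W\<close> with exactly one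
  fixed point. For \<open>n = 3\<close> and \<open>n = 4\<close> this leaves 5 or 7 points with three such involutions \<open>a\<close>, \<open>b\<close>, \<open>c\<close>,
  regarded as a graph with three colours of edges.

    \<^item> If the three fixed points coincide, the other points form a cubic graph in which double edges,
      triangles and 4-cycles coloured \<open>a\<close>, \<open>b\<close>, \<open>a\<close>, \<open>c\<close> each produce two equal unions. The only
      candidates on 4 and 6 vertices are the complete graph, which has triangles, and the complete bipartite
      graph, which has such 4-cycles.
    \<^item> Exactly two equal fixed points are impossible.
    \<^item> If they are distinct, the union around the path that starts in a fixed point with two edges of different
      colours forces the path to close up or to turn back. So there are either two double edges
      or a triangle at each fixed point. If all three triangles are the same, there is a conflict at once.
      Otherwise these edges use up seven points, so that the remaining edges are determined, and a
      conflict appears.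

  Upper bound. Explicit sets with \<open>2 * n\<close> elements serve for \<open>n = 3\<close> and \<open>n = 4\<close>. For \<open>n \<ge> 5\<close> a set for
  \<open>n + 4\<close> is made from one for \<open>n\<close> by adding eight vertices with new coordinates whose three
  pairings form the Wagner graph (\<open>extendable_Un_ladder\<close>). A union then splits into an old and a new part,
  and each of them determines the coordinates that fall into it. The starting points are \<open>n = 1\<close>, which
  yields \<open>n = 5\<close>, and explicit sets for \<open>n = 6, 7, 8\<close>, which are checked by a decision tree.
\<close>

section \<open>Distances and separation of vertices\<close>

definition meets :: "nat \<times> nat \<times> nat \<Rightarrow> nat \<times> nat \<times> nat \<Rightarrow> bool" where
  "meets s w \<longleftrightarrow> fst s = fst w \<or> fst (snd s) = fst (snd w) \<or> snd (snd s) = snd (snd w)"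

definition separated :: "(nat \<times> nat \<times> nat) set \<Rightarrow> nat \<times> nat \<times> nat \<Rightarrow> nat \<times> nat \<times> nat \<Rightarrow> bool" where
  "separated W s t \<longleftrightarrow> (\<exists>w\<in>W. meets s w \<noteq> meets t w)"

abbreviation cube :: "nat \<Rightarrow> (nat \<times> nat \<times> nat) set" where
  "cube n \<equiv> {1..n} \<times> {1..n} \<times> {1..n}"

lemma avoid_two:
  assumes "m \<ge> 3"
  obtains c where "c \<in> {1..m}" "c \<noteq> a" "c \<noteq> (b::nat)"
proof -
  have "card ({1..m} - {a, b}) \<ge> card {1..m} - card {a, b}" by (rule diff_card_le_card_Diff) simp
  moreover have "card {a, b} \<le> 2" by (simp add: card_insert_if)
  ultimately have "0 < card ({1..m} - {a, b})" using assms by (simp del: card_gt_0_iff)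
  then obtain c where "c \<in> {1..m} - {a, b}" by (metis card.empty less_irrefl ex_in_conv)
  then show thesis by (intro that[of c]) auto
qed

text \<open>
  The diameter is two: for \<open>n \<ge> 3\<close> any two vertices have a common neighbour, because in each coordinate
  some value differs from the two that have to be avoided.
\<close>

lemma gdist_HG3:
  assumes n: "n \<ge> 3" and x: "x \<in> cube n" and y: "y \<in> cube n" and "x \<noteq> y"
  shows "pre_digraph.gdist (HG3 n n n) x y = (if meets x y then 2 else 1)"
proof -
  interpret pair_graph "HG3 n n n" by (rule pair_graph_HG3)
  have arc_iff: "(s, t) \<in> parcs (HG3 n n n) \<longleftrightarrow> s \<in> cube n \<and> t \<in> cube n \<and> \<not> meets s t" for s t
    by (cases s; cases t) (auto simp: HG3_def meets_def)
  have verts: "pverts (HG3 n n n) = cube n"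
    by (simp add: HG3_def)
  have not_0: "\<not> apath x p y" if "length p = 0" for p
    using that \<open>x \<noteq> y\<close> by (auto simp: apath_def)
  have iff_1: "(\<exists>p. apath x p y \<and> length p = 1) \<longleftrightarrow> \<not> meets x y"
  proof
    assume "\<exists>p. apath x p y \<and> length p = 1"
    then obtain e where "apath x [e] y"
      by (metis One_nat_def length_0_conv length_Suc_conv)
    then show "\<not> meets x y"
      using arc_iff by (cases e) (auto simp: apath_def awalk_simps)
  next
    assume "\<not> meets x y"
    then have "apath x [(x, y)] y"
      using x y \<open>x \<noteq> y\<close> by (auto simp: apath_def awalk_simps arc_iff verts)
    then show "\<exists>p. apath x p y \<and> length p = 1" by (intro exI conjI) auto
  qed
  have ex_2: "\<exists>p. apath x p y \<and> length p = 2"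
  proof -
    obtain z1 where "z1 \<in> {1..n}" "z1 \<noteq> fst x" "z1 \<noteq> fst y" using avoid_two[OF n] by metis
    moreover obtain z2 where "z2 \<in> {1..n}" "z2 \<noteq> fst (snd x)" "z2 \<noteq> fst (snd y)"
      using avoid_two[OF n] by metis
    moreover obtain z3 where "z3 \<in> {1..n}" "z3 \<noteq> snd (snd x)" "z3 \<noteq> snd (snd y)"
      using avoid_two[OF n] by metis
    ultimately have "(z1, z2, z3) \<in> cube n" "\<not> meets x (z1, z2, z3)" "\<not> meets (z1, z2, z3) y"
      by (auto simp: meets_def)
    moreover from this have "(z1, z2, z3) \<noteq> x" "(z1, z2, z3) \<noteq> y" by (auto simp: meets_def)
    ultimately have "apath x [(x, (z1, z2, z3)), ((z1, z2, z3), y)] y"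
      using x y \<open>x \<noteq> y\<close> by (auto simp: apath_def awalk_simps arc_iff verts)
    then show ?thesis by (intro exI conjI) auto
  qed
  show ?thesis
  proof (cases "meets x y")
    case True
    have "gdist x y = 2" unfolding gdist_def
    proof (rule Least_equality)
      show "\<exists>p. apath x p y \<and> length p = 2" by (rule ex_2)
      fix k assume k: "\<exists>p. apath x p y \<and> length p = k"
      then have "k \<noteq> 0" "k \<noteq> 1" using not_0 iff_1 True by blast+
      then show "2 \<le> k" by simp
    qed
    then show ?thesis using True by simp
  next
    case False
    have "gdist x y = 1" unfolding gdist_def
    proof (rule Least_equality)
      show "\<exists>p. apath x p y \<and> length p = 1" using iff_1 False by blast
      fix k assume k: "\<exists>p. apath x p y \<and> length p = k"
      then have "k \<noteq> 0" using not_0 by blast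
      then show "1 \<le> k" by simp
    qed
    then show ?thesis using False by simp
  qed
qed

lemma resolving_set_HG3_iff:
  assumes n: "n \<ge> 3"
  shows "pre_digraph.resolving_set (HG3 n n n) W \<longleftrightarrow> W \<subseteq> cube n \<and>
    (\<forall>s \<in> cube n - W. \<forall>t \<in> cube n - W. s \<noteq> t \<longrightarrow> separated W s t)"
proof -
  have verts: "pverts (HG3 n n n) = cube n"
    by (simp add: HG3_def)
  show ?thesis
  proof (cases "W \<subseteq> cube n")
    case True
    have "pre_digraph.gdist (HG3 n n n) s w = (if meets s w then 2 else 1)"
      if "s \<in> cube n - W" "w \<in> W" for s w
      using that True by (intro gdist_HG3[OF n]) auto
    then have "(\<exists>w\<in>W. pre_digraph.gdist (HG3 n n n) s w \<noteq> pre_digraph.gdist (HG3 n n n) t w)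
        \<longleftrightarrow> separated W s t"
      if "s \<in> cube n - W" "t \<in> cube n - W" for s t
      unfolding separated_def using that by (intro bex_cong refl) simp
    then show ?thesis
      unfolding pre_digraph.resolving_set_def with_proj_simps verts
      by (intro conj_cong ball_cong imp_cong refl)
  next
    case False
    then show ?thesis unfolding pre_digraph.resolving_set_def with_proj_simps verts by simp
  qed
qed

section \<open>Small resolving sets\<close>

text \<open>
  A decision tree that queries the elements of the first list one after the other. The vertices of the
  second list are pairwise separated by these queries if every branch ends with at most one vertex;
  \<open>tl ts = []\<close> expresses this for the list of a branch. Stopping as soon as this happens keeps the
  evaluation short.
\<close>

primrec splits :: "(nat \<times> nat \<times> nat) list \<Rightarrow> (nat \<times> nat \<times> nat) list \<Rightarrow> bool" where
  "splits [] ts \<longleftrightarrow> tl ts = []"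
| "splits (w # ws) ts \<longleftrightarrow> (if tl ts = [] then True
     else splits ws (filter (\<lambda>t. meets t w) ts) \<and> splits ws (filter (\<lambda>t. \<not> meets t w) ts))"

lemma splits_separated:
  assumes "splits ws ts" "s \<in> set ts" "t \<in> set ts" "s \<noteq> t"
  shows "separated (set ws) s t"
proof -
  have short: False if "tl us = []" "s \<in> set us" "t \<in> set us" for us
    using that \<open>s \<noteq> t\<close> by (cases us) auto
  show ?thesis
    using assms
  proof (induction ws arbitrary: ts)
    case Nil
    then show ?case using short[of ts] by simp
  next
    case (Cons w ws)
    then have "splits ws (filter (\<lambda>t. meets t w) ts)" "splits ws (filter (\<lambda>t. \<not> meets t w) ts)"
      using short[of ts] by (auto split: if_splits)
    then have "meets s w = meets t w \<Longrightarrow> separated (set ws) s t"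
      using Cons by (cases "meets s w") auto
    then show ?case by (auto simp: separated_def)
  qed
qed

definition triples :: "nat list \<Rightarrow> nat list \<Rightarrow> nat list \<Rightarrow> (nat \<times> nat \<times> nat) list \<Rightarrow> (nat \<times> nat \<times> nat) list" where
  "triples xs ys zs ws = filter (\<lambda>t. t \<notin> set ws) (List.product xs (List.product ys zs))"

text \<open>
  In a set that is composed of two blocks with disjoint ranges of coordinates, a vertex may have some
  coordinates in one block and some in the other. From inside a block, a coordinate that belongs to
  the other one meets nothing. It is represented by the value 0, which occurs in no vertex.
\<close>

definition same_support :: "nat \<times> nat \<times> nat \<Rightarrow> nat \<times> nat \<times> nat \<Rightarrow> bool" where
  "same_support s t \<longleftrightarrow> (fst s = 0 \<longleftrightarrow> fst t = 0) \<and> (fst (snd s) = 0 \<longleftrightarrow> fst (snd t) = 0)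
     \<and> (snd (snd s) = 0 \<longleftrightarrow> snd (snd t) = 0)"

text \<open>
  The invariant of the extension by four. Vertices with the same pattern of
  absent coordinates have to be separated, and every value has to be in use in
  each coordinate, so that the presence of a coordinate can be noticed.
\<close>

definition extendable :: "nat \<Rightarrow> (nat \<times> nat \<times> nat) set \<Rightarrow> bool" where
  "extendable n W \<longleftrightarrow> W \<subseteq> cube n \<and>
    (\<forall>s t. s \<in> {..n} \<times> {..n} \<times> {..n} - W \<longrightarrow> t \<in> {..n} \<times> {..n} \<times> {..n} - W \<longrightarrow>
       same_support s t \<longrightarrow> s \<noteq> t \<longrightarrow> separated W s t) \<and>
    (\<forall>f \<in> {fst, fst \<circ> snd, snd \<circ> snd}. {1..n} \<subseteq> f ` W)"

lemma extendableI:
  assumes "W \<subseteq> cube n"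
    and "\<And>s t. s \<in> {..n} \<times> {..n} \<times> {..n} - W \<Longrightarrow> t \<in> {..n} \<times> {..n} \<times> {..n} - W \<Longrightarrow>
       same_support s t \<Longrightarrow> s \<noteq> t \<Longrightarrow> separated W s t"
    and "\<And>f. f \<in> {fst, fst \<circ> snd, snd \<circ> snd} \<Longrightarrow> {1..n} \<subseteq> f ` W"
  shows "extendable n W"
  unfolding extendable_def by (intro conjI allI impI ballI) (fact assms)+

lemma extendable_separated:
  assumes "extendable n W" "s \<in> {..n} \<times> {..n} \<times> {..n} - W" "t \<in> {..n} \<times> {..n} \<times> {..n} - W"
    and "same_support s t" "s \<noteq> t"
  shows "separated W s t"
proof -
  have "\<forall>s t. s \<in> {..n} \<times> {..n} \<times> {..n} - W \<longrightarrow> t \<in> {..n} \<times> {..n} \<times> {..n} - W \<longrightarrow>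
       same_support s t \<longrightarrow> s \<noteq> t \<longrightarrow> separated W s t"
    using assms(1) unfolding extendable_def by (elim conjE)
  from this[rule_format, OF assms(2-)] show ?thesis .
qed

lemma extendable_covers:
  assumes "extendable n W" "f \<in> {fst, fst \<circ> snd, snd \<circ> snd}"
  shows "{1..n} \<subseteq> f ` W"
proof -
  have "\<forall>f \<in> {fst, fst \<circ> snd, snd \<circ> snd}. {1..n} \<subseteq> f ` W"
    using assms(1) unfolding extendable_def by (elim conjE)
  then show ?thesis using assms(2) by (rule bspec)
qed

text \<open>
  Going through the list cyclically, the first and the second coordinate alternately pair neighbours
  in an 8-cycle, and the third coordinate pairs opposite points. This is the Wagner graph, the Moebius
  ladder on eight vertices.
\<close>

definition ladder :: "(nat \<times> nat \<times> nat) list" where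
  "ladder = [(1, 1, 1), (1, 2, 2), (2, 2, 3), (2, 3, 4), (3, 3, 1), (3, 4, 2), (4, 4, 3), (4, 1, 4)]"

definition zero_free :: "nat \<times> nat \<times> nat \<Rightarrow> bool" where
  "zero_free s \<longleftrightarrow> fst s \<noteq> 0 \<and> fst (snd s) \<noteq> 0 \<and> snd (snd s) \<noteq> 0"

lemma set_triples: "set (triples xs ys zs ws) = set xs \<times> set ys \<times> set zs - set ws"
  by (auto simp: triples_def)

lemma ladder_sub: "set ladder \<subseteq> cube 4"
  by (simp add: ladder_def)

text \<open>
  Two vertices with different patterns of absent coordinates are also separated here, provided that
  both or neither have an absent coordinate. This proviso is needed: a path of three edges with
  different colours covers the same points with and without its middle edge.
\<close>

lemma ladder_separated:
  assumes "s \<in> {..4} \<times> {..4} \<times> {..4} - set ladder" "t \<in> {..4} \<times> {..4} \<times> {..4} - set ladder"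
    and "zero_free s \<longleftrightarrow> zero_free t" "s \<noteq> t"
  shows "separated (set ladder) s t"
proof (rule splits_separated)
  let ?T = "triples [0..<5] [0..<5] [0..<5] ladder"
  have "splits ladder (filter zero_free ?T)" "splits ladder (filter (\<lambda>u. \<not> zero_free u) ?T)"
    by code_simp+
  then show "splits ladder (filter (\<lambda>u. zero_free u = zero_free s) ?T)"
    by (cases "zero_free s") simp_all
  have "u \<in> set ?T" if "u \<in> {..4} \<times> {..4} \<times> {..4} - set ladder" for u
    using that by (auto simp: triples_def simp del: upt_Suc)
  then show "s \<in> set (filter (\<lambda>u. zero_free u = zero_free s) ?T)"
    "t \<in> set (filter (\<lambda>u. zero_free u = zero_free s) ?T)" using assms by auto
qed fact

text \<open>
  In the composed set, \<open>low\<close> is what the old block sees of a vertex and \<open>high\<close> is what the new one,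
  shifted by \<open>n\<close>, sees of it. Truncated subtraction turns the old values into 0 as desired.
\<close>

definition shift :: "nat \<Rightarrow> nat \<times> nat \<times> nat \<Rightarrow> nat \<times> nat \<times> nat" where
  "shift n = map_prod (\<lambda>i. i + n) (map_prod (\<lambda>i. i + n) (\<lambda>i. i + n))"

definition low :: "nat \<Rightarrow> nat \<times> nat \<times> nat \<Rightarrow> nat \<times> nat \<times> nat" where
  "low n = map_prod (\<lambda>i. if i \<le> n then i else 0)
     (map_prod (\<lambda>i. if i \<le> n then i else 0) (\<lambda>i. if i \<le> n then i else 0))"

definition high :: "nat \<Rightarrow> nat \<times> nat \<times> nat \<Rightarrow> nat \<times> nat \<times> nat" where
  "high n = map_prod (\<lambda>i. i - n) (map_prod (\<lambda>i. i - n) (\<lambda>i. i - n))"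

lemma separated_Un_shift:
  assumes "W \<subseteq> cube n" "V \<subseteq> cube m"
  shows "separated (W \<union> shift n ` V) s t \<longleftrightarrow>
    separated W (low n s) (low n t) \<or> separated V (high n s) (high n t)"
proof -
  have "meets (low n u) w \<longleftrightarrow> meets u w" if "w \<in> W" for u w
  proof -
    have "(if i \<le> n then i else 0) = j \<longleftrightarrow> i = j" if "1 \<le> j" "j \<le> n" for i j :: nat
      using that by auto
    then show ?thesis
      using subsetD[OF assms(1) that] by (cases u; cases w) (simp add: meets_def low_def)
  qed
  moreover have "meets (high n u) v \<longleftrightarrow> meets u (shift n v)" if "v \<in> V" for u v
  proof -
    have "i - n = j \<longleftrightarrow> i = j + n" if "1 \<le> j" for i j :: nat
      using that by arith
    then show ?thesis
      using subsetD[OF assms(2) that] by (cases u; cases v) (simp add: meets_def high_def shift_def)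
  qed
  ultimately show ?thesis unfolding separated_def by blast
qed

lemma separated_commute: "separated W s t \<longleftrightarrow> separated W t s"
  unfolding separated_def by metis

text \<open>
  If the new block does not tell two vertices apart by their high parts, these parts are equal, or else exactly
  one of them is complete. In the first case the low parts are different, but with equal support, so that the
  old block separates them. In the second case the low part of one vertex is entirely absent, whereas
  that of the other has a value which is in use in the old block.
\<close>

lemma extendable_Un_ladder:
  assumes W: "extendable n W"
  shows "extendable (n + 4) (W \<union> shift n ` set ladder)" (is "extendable _ ?W")
proof -
  have sub: "W \<subseteq> cube n" and surj: "{1..n} \<subseteq> fst ` W" "{1..n} \<subseteq> (fst \<circ> snd) ` W" "{1..n} \<subseteq> (snd \<circ> snd) ` W"
    using W by (simp_all add: extendable_def)
  have sep_mixed: "separated W (low n s) (low n t)"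
    if "zero_free (high n s)" "\<not> zero_free (high n t)" "same_support s t" for s t
  proof -
    have "\<exists>w\<in>W. meets (low n t) w"
    proof -
      have "fst (low n t) \<in> {1..n} \<or> fst (snd (low n t)) \<in> {1..n} \<or> snd (snd (low n t)) \<in> {1..n}"
        using that by (cases s; cases t) (auto simp: zero_free_def same_support_def low_def high_def)
      then have "fst (low n t) \<in> fst ` W \<or> fst (snd (low n t)) \<in> (fst \<circ> snd) ` W
          \<or> snd (snd (low n t)) \<in> (snd \<circ> snd) ` W"
        using surj by blast
      then show ?thesis by (elim disjE imageE) (auto simp: meets_def)
    qed
    moreover have "\<not> meets (low n s) w" if "w \<in> W" for w
      using \<open>zero_free (high n s)\<close> subsetD[OF sub that]
      by (cases s) (auto simp: zero_free_def meets_def low_def high_def)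
    ultimately show ?thesis by (auto simp: separated_def)
  qed
  have "separated ?W s t"
    if s: "s \<in> {..n+4} \<times> {..n+4} \<times> {..n+4} - ?W" and t: "t \<in> {..n+4} \<times> {..n+4} \<times> {..n+4} - ?W"
      and st: "same_support s t" "s \<noteq> t" for s t
  proof -
    have low: "low n u \<in> {..n} \<times> {..n} \<times> {..n} - W"
      if "u \<in> {..n+4} \<times> {..n+4} \<times> {..n+4} - ?W" for u
    proof -
      have "low n u = u" if "low n u \<in> W"
        using subsetD[OF sub that] by (cases u) (auto simp: low_def split: if_splits)
      then show ?thesis using that by (cases u) (auto simp: low_def)
    qed
    have high: "high n u \<in> {..4} \<times> {..4} \<times> {..4} - set ladder"
      if "u \<in> {..n+4} \<times> {..n+4} \<times> {..n+4} - ?W" for u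
    proof -
      have "u = shift n (high n u)" if "high n u \<in> set ladder"
        using subsetD[OF ladder_sub that] by (cases u) (auto simp: high_def shift_def)
      then have "high n u \<notin> set ladder" using that by blast
      then show ?thesis using that by (cases u) (auto simp: high_def)
    qed
    consider "zero_free (high n s)" "\<not> zero_free (high n t)"
      | "zero_free (high n t)" "\<not> zero_free (high n s)"
      | "zero_free (high n s) = zero_free (high n t)" "high n s \<noteq> high n t"
      | "high n s = high n t"
      by blast
    then have "separated W (low n s) (low n t) \<or> separated (set ladder) (high n s) (high n t)"
    proof cases
      case 1
      then show ?thesis using sep_mixed st(1) by blast
    next
      case 2
      moreover have "same_support t s" using st(1) by (auto simp: same_support_def)
      ultimately show ?thesis using sep_mixed separated_commute by blast
    next
      case 3
      then show ?thesis using ladder_separated[OF high[OF s] high[OF t]] by simp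
    next
      case 4
      define lo where "lo i = (if i \<le> n then i else 0)" for i
      have zero: "lo i = 0 \<longleftrightarrow> lo j = 0" and inj: "lo i = lo j \<Longrightarrow> i = j"
        if "i - n = j - n" "i = 0 \<longleftrightarrow> j = 0" for i j :: nat
        using that by (auto simp: lo_def split: if_splits)
      have low_lo: "low n = map_prod lo (map_prod lo lo)"
        by (simp add: low_def lo_def fun_eq_iff)
      obtain s1 s2 s3 t1 t2 t3 where tuples: "s = (s1, s2, s3)" "t = (t1, t2, t3)"
        by (metis prod_cases3)
      have eq: "s1 - n = t1 - n" "s2 - n = t2 - n" "s3 - n = t3 - n"
        using 4 by (simp_all add: high_def tuples)
      have zeros: "s1 = 0 \<longleftrightarrow> t1 = 0" "s2 = 0 \<longleftrightarrow> t2 = 0" "s3 = 0 \<longleftrightarrow> t3 = 0"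
        using st(1) by (simp_all add: same_support_def tuples)
      have "same_support (low n s) (low n t)"
        using zero[OF eq(1) zeros(1)] zero[OF eq(2) zeros(2)] zero[OF eq(3) zeros(3)]
        by (simp add: same_support_def low_lo tuples)
      moreover have "low n s \<noteq> low n t"
        using inj[OF eq(1) zeros(1)] inj[OF eq(2) zeros(2)] inj[OF eq(3) zeros(3)] st(2)
        by (simp add: low_lo tuples) blast
      ultimately show ?thesis using extendable_separated[OF W low[OF s] low[OF t]] by simp
    qed
    then show ?thesis by (simp only: separated_Un_shift[OF sub ladder_sub])
  qed
  note sep = this
  have sub': "?W \<subseteq> cube (n + 4)"
  proof -
    have "cube n \<subseteq> cube (n + 4)" by auto
    moreover have "shift n v \<in> cube (n + 4)" if "v \<in> set ladder" for v
      using subsetD[OF ladder_sub that] by (cases v) (simp add: shift_def)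
    ultimately show ?thesis using sub by blast
  qed
  have covers: "{1..n+4} \<subseteq> f ` ?W"
    if f: "{1..n} \<subseteq> f ` W" "{1..4} \<subseteq> f ` set ladder" "\<And>v. f (shift n v) = f v + n" for f
  proof
    fix i assume i: "i \<in> {1..n+4}"
    show "i \<in> f ` ?W"
    proof (cases "i \<le> n")
      case True
      then show ?thesis using f(1) i by auto
    next
      case False
      then have "i - n \<in> {1..4}" using i by auto
      then have "i - n \<in> f ` set ladder" using f(2) by blast
      then obtain v where "v \<in> set ladder" "i - n = f v" by blast
      then have "i = f (shift n v)" using f(3) False by simp
      then show ?thesis using \<open>v \<in> set ladder\<close> by blast
    qed
  qed
  have covers_ladder: "{1..4} \<subseteq> f ` set ladder" if "f \<in> {fst, fst \<circ> snd, snd \<circ> snd}" for f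
  proof -
    have "{1..4} = {1, 2, 3, 4 :: nat}" by auto
    moreover have "\<forall>f \<in> {fst, fst \<circ> snd, snd \<circ> snd}. \<forall>i \<in> {1, 2, 3, 4}. i \<in> f ` set ladder"
      by (simp add: ladder_def)
    ultimately show ?thesis using that by blast
  qed
  show ?thesis
  proof (rule extendableI[OF sub' sep])
    fix f assume f: "f \<in> {fst, fst \<circ> snd, snd \<circ> snd :: nat \<times> nat \<times> nat \<Rightarrow> nat}"
    have "{1..n} \<subseteq> f ` W" using W f by (rule extendable_covers)
    moreover have "f (shift n v) = f v + n" for v using f by (cases v) (auto simp: shift_def)
    ultimately show "{1..n+4} \<subseteq> f ` ?W" using covers covers_ladder[OF f] by simp
  qed
qed

lemma card_Un_ladder:
  assumes "W \<subseteq> cube n"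
  shows "card (W \<union> shift n ` set ladder) = card W + 8"
proof -
  have "finite W" using assms by (rule finite_subset) simp
  have "inj (shift n)" by (auto simp: inj_def shift_def)
  then have "card (shift n ` set ladder) = 8"
    by (simp add: card_image[OF inj_on_subset[OF _ subset_UNIV]]) (simp add: ladder_def)
  moreover have "fst w \<le> n" if "w \<in> W" for w
    using subsetD[OF assms that] by (cases w) simp
  moreover have "n < fst (shift n v)" if "v \<in> set ladder" for v
    using subsetD[OF ladder_sub that] by (cases v) (simp add: shift_def)
  ultimately have "card (shift n ` set ladder) = 8" "W \<inter> shift n ` set ladder = {}"
    unfolding disjoint_iff by (blast, metis imageE leD)
  then show ?thesis using \<open>finite W\<close> by (simp add: card_Un_disjoint)
qed

lemma extendable_listI:
  assumes in_cube: "list_all (\<lambda>(i, j, k). 1 \<le> i \<and> i \<le> n \<and> 1 \<le> j \<and> j \<le> n \<and> 1 \<le> k \<and> k \<le> n) ws"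
    and splits: "\<forall>xs\<in>{[0], [1..<Suc n]}. \<forall>ys\<in>{[0], [1..<Suc n]}. \<forall>zs\<in>{[0], [1..<Suc n]}.
      splits ws (triples xs ys zs ws)"
    and all_values: "\<forall>i\<in>set [1..<Suc n]. list_ex (\<lambda>w. fst w = i) ws \<and> list_ex (\<lambda>w. fst (snd w) = i) ws
      \<and> list_ex (\<lambda>w. snd (snd w) = i) ws"
  shows "extendable n (set ws)"
proof -
  have sub: "set ws \<subseteq> cube n"
    using in_cube by (auto simp: list_all_iff)
  have "separated (set ws) s t"
    if s: "s \<in> {..n} \<times> {..n} \<times> {..n} - set ws" and t: "t \<in> {..n} \<times> {..n} \<times> {..n} - set ws"
      and "same_support s t" "s \<noteq> t" for s t
  proof -
    define layer where "layer i = (if i = 0 then [0] else [1..<Suc n])" for i :: nat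
    let ?T = "triples (layer (fst s)) (layer (fst (snd s))) (layer (snd (snd s))) ws"
    have in_layer: "i \<in> set (layer j)" if "i \<le> n" "i = 0 \<longleftrightarrow> j = 0" for i j
      using that by (auto simp: layer_def simp del: upt_Suc)
    have "s \<in> set ?T"
      using s in_layer by (cases s) (simp add: set_triples)
    moreover have "t \<in> set ?T"
      using t in_layer \<open>same_support s t\<close> by (cases t) (simp add: set_triples same_support_def)
    moreover have "layer i \<in> {[0], [1..<Suc n]}" for i
      by (simp add: layer_def)
    then have "splits ws ?T" by (intro splits[rule_format])
    ultimately show ?thesis using splits_separated \<open>s \<noteq> t\<close> by blast
  qed
  note sep = this
  show ?thesis
  proof (rule extendableI[OF sub sep])
    show "{1..n} \<subseteq> f ` set ws" if "f \<in> {fst, fst \<circ> snd, snd \<circ> snd}" for f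
    proof
      fix i assume "i \<in> {1..n}"
      then have "i \<in> set [1..<Suc n]" by (simp del: upt_Suc)
      from bspec[OF all_values this] obtain x y z
        where "x \<in> set ws" "y \<in> set ws" "z \<in> set ws" "i = fst x" "i = fst (snd y)" "i = snd (snd z)"
        unfolding list_ex_iff by metis
      moreover have "f = fst \<or> f = fst \<circ> snd \<or> f = snd \<circ> snd" using that by simp
      ultimately show "i \<in> f ` set ws"
        unfolding image_iff comp_def by metis
    qed
  qed
qed

text \<open>
  A single vertex for \<open>n = 1\<close>. Extended once, it is the isolated point next to the Wagner graph that
  gives the set for \<open>n = 5\<close>.
\<close>

lemma extendable_1: "extendable 1 {(1, 1, 1)}"
proof (rule extendableI)
  fix s t :: "nat \<times> nat \<times> nat"
  assume "s \<in> {..1} \<times> {..1} \<times> {..1} - {(1, 1, 1)}" "t \<in> {..1} \<times> {..1} \<times> {..1} - {(1, 1, 1)}"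
    "same_support s t" "s \<noteq> t"
  moreover have bit: "i = j" if "i \<le> 1" "j \<le> 1" "i = 0 \<longleftrightarrow> j = 0" for i j :: nat
    using that by arith
  have "s = t" if "s \<in> {..1} \<times> {..1} \<times> {..1}" "t \<in> {..1} \<times> {..1} \<times> {..1}" "same_support s t"
    using that by (intro prod_eqI bit) (simp_all add: mem_Times_iff same_support_def)
  ultimately show "separated {(1, 1, 1)} s t" by blast
qed auto

text \<open>
  These three sets start the residue classes of 2, 3 and 0 modulo 4. They were found by computer search,
  except \<open>base_7\<close>, which is the Moebius ladder on 12 vertices with an isolated point. The set \<open>base_8\<close>
  has an isolated point as well, whereas the singleton classes of \<open>base_6\<close> in the three coordinates
  belong to different points.
\<close>

definition base_6 :: "(nat \<times> nat \<times> nat) list" where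
  "base_6 = [(1, 4, 2), (1, 6, 3), (2, 1, 2), (2, 4, 3), (3, 2, 6), (3, 3, 5), (4, 1, 4),
     (4, 5, 1), (5, 3, 1), (5, 5, 4), (6, 2, 5)]"

definition base_7 :: "(nat \<times> nat \<times> nat) list" where
  "base_7 = [(1, 1, 1), (1, 2, 2), (2, 2, 3), (2, 3, 4), (3, 3, 5), (3, 4, 6), (4, 4, 1),
     (4, 5, 2), (5, 5, 3), (5, 6, 4), (6, 6, 5), (6, 1, 6), (7, 7, 7)]"

definition base_8 :: "(nat \<times> nat \<times> nat) list" where
  "base_8 = [(1, 1, 1), (1, 2, 2), (2, 2, 3), (2, 3, 4), (3, 4, 5), (3, 5, 6), (4, 6, 2),
     (4, 7, 6), (5, 7, 3), (5, 1, 7), (6, 6, 7), (6, 3, 5), (7, 5, 1), (7, 4, 4), (8, 8, 8)]"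

lemma extendable_6: "extendable 6 (set base_6)"
  by (rule extendable_listI; code_simp)

lemma extendable_7: "extendable 7 (set base_7)"
  by (rule extendable_listI; code_simp)

lemma extendable_8: "extendable 8 (set base_8)"
  by (rule extendable_listI; code_simp)

lemma ex_extendable:
  assumes "n \<ge> 5"
  shows "\<exists>W. extendable n W \<and> card W = 2 * n - 1"
  using assms
proof (induction n rule: less_induct)
  case (less n)
  have step: "\<exists>W. extendable n W \<and> card W = 2 * n - 1"
    if "extendable m W" "card W = 2 * m - 1" "n = m + 4" "m \<ge> 1" for m W
  proof -
    have "card (W \<union> shift m ` set ladder) = 2 * n - 1"
      using that card_Un_ladder[of W m] by (simp add: extendable_def)
    then show ?thesis using extendable_Un_ladder[OF that(1)] that(3) by blast
  qed
  consider "n = 5" | "n = 6" | "n = 7" | "n = 8" | "n \<ge> 9" using less.prems by linarith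
  then show ?case
  proof cases
    case 1
    then show ?thesis using step[OF extendable_1] by simp
  next
    case 2
    have "card (set base_6) = 11" by (simp add: base_6_def)
    then show ?thesis using 2 extendable_6 by (intro exI[of _ "set base_6"]) simp
  next
    case 3
    have "card (set base_7) = 13" by (simp add: base_7_def)
    then show ?thesis using 3 extendable_7 by (intro exI[of _ "set base_7"]) simp
  next
    case 4
    have "card (set base_8) = 15" by (simp add: base_8_def)
    then show ?thesis using 4 extendable_8 by (intro exI[of _ "set base_8"]) simp
  next
    case 5
    then have "\<exists>W. extendable (n - 4) W \<and> card W = 2 * (n - 4) - 1"
      by (intro less.IH) auto
    then obtain W where "extendable (n - 4) W" "card W = 2 * (n - 4) - 1" by blast
    then show ?thesis using 5 by (intro step[of "n - 4" W]) simp_all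
  qed
qed

lemma extendable_resolving:
  assumes "n \<ge> 3" and W: "extendable n W"
  shows "pre_digraph.resolving_set (HG3 n n n) W"
  unfolding resolving_set_HG3_iff[OF \<open>n \<ge> 3\<close>]
proof (intro conjI ballI impI)
  show "W \<subseteq> cube n" using W by (simp add: extendable_def)
  fix s t assume "s \<in> cube n - W" "t \<in> cube n - W" "s \<noteq> t"
  then show "separated W s t"
    by (intro extendable_separated[OF W]) (auto simp: same_support_def)
qed

lemma resolving_listI:
  assumes "n \<ge> 3" "set ws \<subseteq> cube n" "splits ws (triples [1..<Suc n] [1..<Suc n] [1..<Suc n] ws)"
  shows "pre_digraph.resolving_set (HG3 n n n) (set ws)"
  unfolding resolving_set_HG3_iff[OF \<open>n \<ge> 3\<close>]
proof (intro conjI ballI impI)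
  show "set ws \<subseteq> cube n" by fact
  have in_triples: "u \<in> set (triples [1..<Suc n] [1..<Suc n] [1..<Suc n] ws)" if "u \<in> cube n - set ws" for u
    using that by (auto simp: set_triples simp del: upt_Suc)
  fix s t assume "s \<in> cube n - set ws" "t \<in> cube n - set ws" "s \<noteq> t"
  then show "separated (set ws) s t"
    by (intro splits_separated[OF assms(3)] in_triples)
qed

text \<open>
  Sets with \<open>2 * n\<close> vertices for \<open>n = 3\<close> and \<open>n = 4\<close>, found by computer search.
\<close>

definition six_vertices :: "(nat \<times> nat \<times> nat) list" where
  "six_vertices = [(1, 1, 3), (1, 2, 2), (1, 3, 1), (2, 1, 1), (2, 2, 3), (3, 2, 1)]"

definition eight_vertices :: "(nat \<times> nat \<times> nat) list" where
  "eight_vertices = [(1, 1, 4), (2, 2, 1), (2, 4, 2), (3, 2, 2), (3, 4, 1), (4, 1, 3), (4, 1, 4), (4, 3, 4)]"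

lemma resolving_3: "pre_digraph.resolving_set (HG3 3 3 3) (set six_vertices)"
proof (rule resolving_listI)
  show "set six_vertices \<subseteq> cube 3" by (simp add: six_vertices_def)
  show "splits six_vertices (triples [1..<Suc 3] [1..<Suc 3] [1..<Suc 3] six_vertices)" by code_simp
qed simp

lemma resolving_4: "pre_digraph.resolving_set (HG3 4 4 4) (set eight_vertices)"
proof (rule resolving_listI)
  show "set eight_vertices \<subseteq> cube 4" by (simp add: eight_vertices_def)
  show "splits eight_vertices (triples [1..<Suc 4] [1..<Suc 4] [1..<Suc 4] eight_vertices)" by code_simp
qed simp

lemma ex_resolving:
  assumes "n \<ge> 3"
  shows "\<exists>W. pre_digraph.resolving_set (HG3 n n n) W \<and>
    card W = (if n \<in> {3, 4} then 2 * n else 2 * n - 1)"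
proof -
  consider "n = 3" | "n = 4" | "n \<ge> 5" using assms by linarith
  then show ?thesis
  proof cases
    case 1
    have "card (set six_vertices) = 6" by (simp add: six_vertices_def)
    then show ?thesis using 1 resolving_3 by (intro exI[of _ "set six_vertices"]) simp
  next
    case 2
    have "card (set eight_vertices) = 8" by (simp add: eight_vertices_def)
    then show ?thesis using 2 resolving_4 by (intro exI[of _ "set eight_vertices"]) simp
  next
    case 3
    then obtain W where "extendable n W" "card W = 2 * n - 1" using ex_extendable by blast
    then show ?thesis using extendable_resolving[OF assms] 3 by (intro exI[of _ W]) auto
  qed
qed

section \<open>Three involutions on five or seven points\<close>

text \<open>
  The orbits of \<open>a\<close>, \<open>b\<close> and \<open>c\<close> are the classes of three partitions of \<open>W\<close> into pairs and one singleton.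
  A class is named by one of its points, so \<open>p\<close>, \<open>q\<close>, \<open>r\<close> stand for the vertex whose union is
  \<open>{p, a p} \<union> {q, b q} \<union> {r, c r}\<close>. The last two disjuncts of \<open>sep\<close> exempt the vertices that belong to the
  resolving set: these are the triples of classes with a common point.
\<close>

locale separating_involutions =
  fixes W :: "'a set" and a b c :: "'a \<Rightarrow> 'a" and u v w :: 'a
  assumes finite: "finite W"
    and a_closed: "x \<in> W \<Longrightarrow> a x \<in> W" and b_closed: "x \<in> W \<Longrightarrow> b x \<in> W" and c_closed: "x \<in> W \<Longrightarrow> c x \<in> W"
    and a_a: "x \<in> W \<Longrightarrow> a (a x) = x" and b_b: "x \<in> W \<Longrightarrow> b (b x) = x" and c_c: "x \<in> W \<Longrightarrow> c (c x) = x"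
    and fixed_in: "u \<in> W" "v \<in> W" "w \<in> W"
    and a_fixed: "x \<in> W \<Longrightarrow> a x = x \<longleftrightarrow> x = u" and b_fixed: "x \<in> W \<Longrightarrow> b x = x \<longleftrightarrow> x = v"
    and c_fixed: "x \<in> W \<Longrightarrow> c x = x \<longleftrightarrow> x = w"
    and sep: "\<lbrakk>p \<in> W; q \<in> W; r \<in> W; p' \<in> W; q' \<in> W; r' \<in> W;
        {p, a p} \<union> {q, b q} \<union> {r, c r} = {p', a p'} \<union> {q', b q'} \<union> {r', c r'}\<rbrakk> \<Longrightarrow>
        p' \<in> {p, a p} \<and> q' \<in> {q, b q} \<and> r' \<in> {r, c r} \<or>
        {p, a p} \<inter> {q, b q} \<inter> {r, c r} \<noteq> {} \<or> {p', a p'} \<inter> {q', b q'} \<inter> {r', c r'} \<noteq> {}"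
begin

lemmas closed = a_closed b_closed c_closed
lemmas inv = a_a b_b c_c

text \<open>
  The three involutions play the same part. The permuted interpretations allow each fact below to be
  proved for one choice of colours.
\<close>

lemma swap_ab: "separating_involutions W b a c v u w"
proof (unfold_locales; (fact finite closed inv fixed_in a_fixed b_fixed c_fixed)?)
  fix p q r p' q' r'
  assume "p \<in> W" "q \<in> W" "r \<in> W" "p' \<in> W" "q' \<in> W" "r' \<in> W"
    and eq: "{p, b p} \<union> {q, a q} \<union> {r, c r} = {p', b p'} \<union> {q', a q'} \<union> {r', c r'}"
  moreover have "{q, a q} \<union> {p, b p} \<union> {r, c r} = {q', a q'} \<union> {p', b p'} \<union> {r', c r'}"
    using eq by (simp only: Un_ac)
  ultimately show "p' \<in> {p, b p} \<and> q' \<in> {q, a q} \<and> r' \<in> {r, c r} \<or>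
      {p, b p} \<inter> {q, a q} \<inter> {r, c r} \<noteq> {} \<or> {p', b p'} \<inter> {q', a q'} \<inter> {r', c r'} \<noteq> {}"
    using sep[of q p r q' p' r'] by blast
qed

lemma swap_bc: "separating_involutions W a c b u w v"
proof (unfold_locales; (fact finite closed inv fixed_in a_fixed b_fixed c_fixed)?)
  fix p q r p' q' r'
  assume "p \<in> W" "q \<in> W" "r \<in> W" "p' \<in> W" "q' \<in> W" "r' \<in> W"
    and eq: "{p, a p} \<union> {q, c q} \<union> {r, b r} = {p', a p'} \<union> {q', c q'} \<union> {r', b r'}"
  moreover have "{p, a p} \<union> {r, b r} \<union> {q, c q} = {p', a p'} \<union> {r', b r'} \<union> {q', c q'}"
    using eq by (simp only: Un_ac)
  ultimately show "p' \<in> {p, a p} \<and> q' \<in> {q, c q} \<and> r' \<in> {r, b r} \<or>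
      {p, a p} \<inter> {q, c q} \<inter> {r, b r} \<noteq> {} \<or> {p', a p'} \<inter> {q', c q'} \<inter> {r', b r'} \<noteq> {}"
    using sep[of p r q p' r' q'] by blast
qed

lemma rotate: "separating_involutions W b c a v w u"
  by (rule separating_involutions.swap_bc[OF swap_ab])

lemma a_eq: "x \<in> W \<Longrightarrow> y \<in> W \<Longrightarrow> a x = y \<longleftrightarrow> x = a y" by (metis a_a)
lemma b_eq: "x \<in> W \<Longrightarrow> y \<in> W \<Longrightarrow> b x = y \<longleftrightarrow> x = b y" by (metis b_b)
lemma c_eq: "x \<in> W \<Longrightarrow> y \<in> W \<Longrightarrow> c x = y \<longleftrightarrow> x = c y" by (metis c_c)

lemma a_moves: "x \<in> W \<Longrightarrow> x \<noteq> u \<Longrightarrow> a x \<noteq> x \<and> a x \<noteq> u" by (metis a_a a_fixed fixed_in(1))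
lemma b_moves: "x \<in> W \<Longrightarrow> x \<noteq> v \<Longrightarrow> b x \<noteq> x \<and> b x \<noteq> v" by (metis b_b b_fixed fixed_in(2))
lemma c_moves: "x \<in> W \<Longrightarrow> x \<noteq> w \<Longrightarrow> c x \<noteq> x \<and> c x \<noteq> w" by (metis c_c c_fixed fixed_in(3))

text \<open>
  Let \<open>x = b u\<close> and \<open>y = a x\<close>. Given the \<open>b\<close>-edge \<open>{u, x}\<close> and the \<open>c\<close>-edge at \<open>y\<close>, neither \<open>{u}\<close> nor
  \<open>{x, y}\<close> adds a point to the union. So one of these two triples has a common point, which puts the
  \<open>c\<close>-edge at \<open>y\<close> through \<open>u\<close> or \<open>x\<close>.
\<close>

lemma path_from_fixed:
  assumes "b u \<noteq> u"
  shows "c (a (b u)) \<in> {u, b u}"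
proof -
  define x where "x = b u"
  define y where "y = a x"
  have W: "u \<in> W" "x \<in> W" "y \<in> W" using fixed_in closed by (auto simp: x_def y_def)
  have a: "a u = u" "a x = y" "b u = x" using fixed_in a_fixed by (auto simp: x_def y_def)
  have ne: "x \<noteq> u" "y \<noteq> x" "y \<noteq> u"
    using assms a_moves[OF W(2)] by (auto simp: x_def y_def)
  have "{u, a u} \<union> {u, b u} \<union> {y, c y} = {x, a x} \<union> {u, b u} \<union> {y, c y}"
    unfolding a by blast
  from sep[OF W(1) W(1) W(3) W(2) W(1) W(3) this] have "c y \<in> {u, x}"
    using ne unfolding a by auto
  then show ?thesis by (simp add: x_def y_def)
qed

text \<open>
  Next to the double edge as \<open>b\<close>-class and the \<open>c\<close>-edge at \<open>u\<close>, the \<open>a\<close>-classes \<open>{u}\<close> and \<open>{x, a x}\<close> are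
  both redundant, so the second triple must be exempt.
\<close>

lemma double_ab:
  assumes "x \<in> W" "a x = b x" "a x \<noteq> x"
  shows "c u \<in> {x, a x}"
proof -
  define y where "y = a x"
  have W: "u \<in> W" "x \<in> W" "y \<in> W" using fixed_in closed assms by (auto simp: y_def)
  have a: "a u = u" "a x = y" "b x = y" using fixed_in a_fixed assms by (auto simp: y_def)
  have ne: "x \<noteq> u" "y \<noteq> x" "y \<noteq> u"
  proof -
    show "x \<noteq> u" using assms a by metis
    then show "y \<noteq> x" "y \<noteq> u" using a_moves[OF W(2)] by (simp_all add: y_def)
  qed
  have "{u, a u} \<union> {x, b x} \<union> {u, c u} = {x, a x} \<union> {x, b x} \<union> {u, c u}"
    unfolding a by blast
  from sep[OF W(1) W(2) W(1) W(2) W(2) W(1) this] have "c u \<in> {x, y}"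
    using ne unfolding a by auto
  then show ?thesis by (simp add: y_def)
qed

text \<open>
  With a common fixed point \<open>u\<close>, the classes \<open>{x, a x}\<close>, \<open>{u}\<close> of the first two colours could be traded for \<open>{u}\<close>,
  \<open>{x, b x}\<close>.
\<close>

lemma no_double_ab:
  assumes "u = v" "x \<in> W" "x \<noteq> u"
  shows "a x \<noteq> b x"
proof
  assume "a x = b x"
  define y where "y = a x"
  have W: "u \<in> W" "x \<in> W" "y \<in> W" using fixed_in closed assms by (auto simp: y_def)
  have a: "a u = u" "b u = u" "a x = y" "b x = y"
    using fixed_in a_fixed b_fixed assms \<open>a x = b x\<close> by (auto simp: y_def)
  have ne: "x \<noteq> u" "y \<noteq> x" "y \<noteq> u"
    using assms a_moves[OF W(2)] by (simp_all add: y_def)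
  have "{x, a x} \<union> {u, b u} \<union> {u, c u} = {u, a u} \<union> {x, b x} \<union> {u, c u}"
    unfolding a by blast
  from sep[OF W(2) W(1) W(1) W(1) W(2) W(1) this] show False
    using ne unfolding a by auto
qed

text \<open>
  Of a triangle, the edge of colour \<open>c\<close> covers two points, and the third one can be added by the edge of colour
  \<open>a\<close> or by the one of colour \<open>b\<close>, the isolated point \<open>u\<close> filling the free place.
\<close>

lemma no_triangle:
  assumes "u = v" "u = w" "p \<in> W" "p \<noteq> u"
  shows "a (b p) \<noteq> c p"
proof
  assume eq: "a (b p) = c p"
  define x where "x = b p"
  define y where "y = c p"
  have W: "u \<in> W" "p \<in> W" "x \<in> W" "y \<in> W" using fixed_in closed assms by (auto simp: x_def y_def)
  have a: "a u = u" "b u = u" "b p = x" "c p = y" "a x = y"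
    using fixed_in a_fixed b_fixed assms eq by (auto simp: x_def y_def)
  have ne: "p \<noteq> u" "x \<noteq> u" "y \<noteq> u" "x \<noteq> p" "y \<noteq> p" "x \<noteq> y"
  proof -
    show "p \<noteq> u" "x \<noteq> u" "y \<noteq> u" "x \<noteq> p" "y \<noteq> p"
      using assms b_moves[of p] c_moves[of p] by (simp_all add: x_def y_def)
    then show "x \<noteq> y" using a_moves[OF W(3)] a by metis
  qed
  have "{u, a u} \<union> {p, b p} \<union> {p, c p} = {x, a x} \<union> {u, b u} \<union> {p, c p}"
    unfolding a by blast
  from sep[OF W(1) W(2) W(2) W(3) W(1) W(2) this] show False
    using ne unfolding a by auto
qed

text \<open>
  The equation would close a 4-cycle through \<open>p\<close> coloured \<open>a\<close>, \<open>c\<close>, \<open>a\<close>, \<open>b\<close>. Its \<open>b\<close>- and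
  \<open>c\<close>-edge cover all four points, so the two \<open>a\<close>-edges are interchangeable.
\<close>

lemma no_square:
  assumes "u = v" "u = w" "p \<in> W" "p \<noteq> u"
  shows "a (b p) \<noteq> c (a p)"
proof
  assume eq: "a (b p) = c (a p)"
  define x where "x = a p"
  define y where "y = b p"
  define z where "z = a y"
  have W: "p \<in> W" "x \<in> W" "y \<in> W" "z \<in> W" using fixed_in closed assms by (auto simp: x_def y_def z_def)
  have a: "a p = x" "b p = y" "a y = z" "c x = z"
    using eq by (auto simp: x_def y_def z_def)
  have ne: "x \<noteq> y" "x \<noteq> p" "y \<noteq> p" "z \<noteq> x" "z \<noteq> y" "z \<noteq> p"
  proof -
    show "x \<noteq> y" using no_double_ab assms by (simp add: x_def y_def)
    show "x \<noteq> p" "y \<noteq> p" using assms a_moves[of p] b_moves[of p] by (simp_all add: x_def y_def)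
    then show "z \<noteq> x" using a a_a W by metis
    have "y \<noteq> u" using assms b_moves[of p] by (simp add: y_def)
    then show "z \<noteq> y" using a_moves W a by metis
    show "z \<noteq> p" using a a_a W \<open>x \<noteq> y\<close> by metis
  qed
  have "{p, a p} \<union> {p, b p} \<union> {x, c x} = {y, a y} \<union> {p, b p} \<union> {x, c x}"
    unfolding a by blast
  from sep[OF W(1) W(1) W(2) W(3) W(1) W(2) this] show False
    using ne unfolding a by auto
qed

text \<open>
  Around a point \<open>p\<close> other than the isolated one, the neighbours \<open>x\<close>, \<open>y\<close>, \<open>z\<close> are distinct and not adjacent to
  each other. This already needs more than five points. With seven points, the neighbours of \<open>x\<close> and
  \<open>y\<close> other than \<open>p\<close> are the two remaining points \<open>g\<close> and \<open>h\<close>, and the colours are such that the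
  excluded 4-cycle \<open>p\<close>, \<open>x\<close>, \<open>h\<close>, \<open>y\<close> appears.
\<close>

lemma common_fixed_point_card:
  assumes "u = v" "u = w"
  shows "card W \<noteq> 5" "card W \<noteq> 7"
proof -
  interpret ba: separating_involutions W b a c v u w by (rule swap_ab)
  interpret ac: separating_involutions W a c b u w v by (rule swap_bc)
  interpret bca: separating_involutions W b c a v w u by (rule rotate)
  interpret cab: separating_involutions W c a b w u v by (rule bca.rotate)
  have bc: "b x \<noteq> c x" and ac: "a x \<noteq> c x" and ab: "a x \<noteq> b x" if "x \<in> W" "x \<noteq> u" for x
    using that assms bca.no_double_ab ac.no_double_ab no_double_ab by auto
  have False if card: "card W = 5 \<or> card W = 7"
  proof -
    have "W \<noteq> {u}" using card by auto
    then obtain p where p: "p \<in> W" "p \<noteq> u" using fixed_in by blast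
    define x where "x = a p"
    define y where "y = b p"
    define z where "z = c p"
    have W: "x \<in> W" "y \<in> W" "z \<in> W" using p closed by (auto simp: x_def y_def z_def)
    have neighbours: "a x = p" "b y = p" "c z = p" using p inv by (auto simp: x_def y_def z_def)
    have neu: "x \<noteq> u" "y \<noteq> u" "z \<noteq> u"
      using p assms a_moves[of p] b_moves[of p] c_moves[of p] by (simp_all add: x_def y_def z_def)
    have fixed: "a u = u" "b u = u" "c u = u"
      using fixed_in a_fixed b_fixed c_fixed assms by auto
    have dist: "distinct [u, p, x, y, z]"
      using neu p a_fixed[OF p(1)] b_fixed[OF p(1)] c_fixed[OF p(1)] assms ab[OF p] bc[OF p] ac[OF p]
      by (auto simp: x_def y_def z_def)
    have ay: "a y \<in> W" "a y \<notin> {u, p, x, y, z}"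
    proof -
      show "a y \<in> W" using W closed by blast
      have "a y \<noteq> z" using no_triangle[OF assms p] by (simp add: y_def z_def)
      then show "a y \<notin> {u, p, x, y, z}"
        using dist neighbours p a_moves[OF W(2) neu(2)] a_a[OF W(2)] a_a[OF p(1)] unfolding x_def by auto
    qed
    show False
    proof (cases "card W = 5")
      case True
      have "{u, p, x, y, z} = W"
        using dist W p fixed_in by (intro card_subset_eq[OF finite]) (auto simp: True)
      then show False using ay by blast
    next
      case False
      then have card7: "card W = 7" using card by blast
      define g where "g = b x"
      define h where "h = c x"
      have gh: "g \<in> W" "h \<in> W" using W closed by (auto simp: g_def h_def)
      have "g \<noteq> h" using bc[OF W(1) neu(1)] by (simp add: g_def h_def)
      moreover have "g \<noteq> z" using ba.no_triangle[of p] assms p by (simp add: g_def x_def z_def)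
      then have "g \<notin> {u, p, x, y, z}"
        using dist neighbours p assms b_moves[OF W(1)] b_b[OF W(1)] b_b[OF p(1)] unfolding g_def y_def by auto
      moreover have "h \<noteq> y" using cab.no_triangle[of p] assms p by (simp add: h_def x_def y_def)
      then have "h \<notin> {u, p, x, y, z}"
        using dist neighbours p assms c_moves[OF W(1)] c_c[OF W(1)] c_c[OF p(1)] unfolding h_def z_def by auto
      ultimately have "distinct [u, p, x, y, z, g, h]" using dist by auto
      then have all: "{u, p, x, y, z, g, h} = W"
        using W p gh fixed_in by (intro card_subset_eq[OF finite]) (auto simp: card7)
      have "c y \<in> W" "c y \<noteq> a y" using W closed ac[OF W(2) neu(2)] by auto
      moreover have "c y \<noteq> h"
        using c_c[OF W(1)] c_c[OF W(2)] dist unfolding h_def by auto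
      moreover have "c y \<notin> {u, p, x, y, z}"
        using dist neighbours p assms c_moves[OF W(2)] c_c[OF W(2)] c_c[OF p(1)] \<open>h \<noteq> y\<close>
        unfolding h_def z_def by auto
      ultimately have "a y = h" using ay all by blast
      then show False using no_square[OF assms p] by (simp add: h_def x_def y_def)
    qed
  qed
  then show "card W \<noteq> 5" "card W \<noteq> 7" by blast+
qed

text \<open>
  Otherwise the path that leaves \<open>u\<close> by a \<open>c\<close>-edge cannot return to \<open>u\<close> by a \<open>b\<close>-edge, so that it
  turns back along a double edge, which the common fixed point rules out.
\<close>

lemma two_fixed_points_equal:
  assumes "u = v"
  shows "u = w"
proof (rule ccontr)
  assume "u \<noteq> w"
  interpret ac: separating_involutions W a c b u w v by (rule swap_bc)
  have "c u \<noteq> u" using \<open>u \<noteq> w\<close> c_fixed fixed_in by blast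
  then have "b (a (c u)) \<in> {u, c u}" by (rule ac.path_from_fixed)
  then show False
  proof
    assume "b (a (c u)) = u"
    then have "a (c u) = u" using b_eq b_fixed fixed_in closed assms by metis
    then show False using \<open>c u \<noteq> u\<close> a_eq a_fixed fixed_in closed by metis
  next
    assume "b (a (c u)) \<in> {c u}"
    then have "a (c u) = b (c u)" using b_eq fixed_in closed by (metis singletonD)
    then show False using no_double_ab[of "c u"] assms \<open>c u \<noteq> u\<close> fixed_in closed by blast
  qed
qed

text \<open>
  The path from \<open>u\<close> that starts with \<open>b\<close> ends in a double edge \<open>{x, x'}\<close> of colours \<open>a\<close>, \<open>c\<close>. Then the one that
  starts with \<open>c\<close> must end in a double edge \<open>{y, y'}\<close> of colours \<open>a\<close>, \<open>b\<close>, and \<open>double_ab\<close> attaches \<open>v\<close> to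
  \<open>y'\<close> and \<open>w\<close> to \<open>x'\<close>. These are seven points in a path; closing it up by \<open>a v = w\<close> violates
  \<open>path_from_fixed\<close> at \<open>v\<close>.
\<close>

lemma two_doubles_card:
  assumes "u \<noteq> v" "u \<noteq> w" "v \<noteq> w" and double: "c (a (b u)) = b u"
  shows "card W \<noteq> 5" "card W \<noteq> 7"
proof -
  interpret ba: separating_involutions W b a c v u w by (rule swap_ab)
  interpret ac: separating_involutions W a c b u w v by (rule swap_bc)
  interpret cab: separating_involutions W c a b w u v by (rule separating_involutions.rotate[OF rotate])
  define x where "x = b u"
  define x' where "x' = a x"
  define y where "y = c u"
  define y' where "y' = a y"
  have W: "x \<in> W" "x' \<in> W" "y \<in> W" "y' \<in> W"
    using fixed_in closed by (auto simp: x_def x'_def y_def y'_def)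
  have cx: "c x' = x" using double by (simp add: x_def x'_def)
  then have cx: "c x' = x" "c x = x'" using c_c[OF W(2)] by simp_all
  have fixed: "a u = u" "b v = v" "c w = w" using fixed_in a_fixed b_fixed c_fixed by auto
  have val: "b u = x" "b x = u" "a x = x'" "a x' = x" "c u = y" "c y = u" "a y = y'" "a y' = y"
    using fixed_in inv W by (auto simp: x_def x'_def y_def y'_def)
  have ne: "x \<noteq> u" "x \<noteq> x'" "y \<noteq> u" "y \<noteq> y'"
    using val fixed assms fixed_in W a_fixed b_fixed c_fixed by metis+
  have "b y' \<in> {u, y}" using ac.path_from_fixed ne val by simp
  moreover have "b y' \<noteq> u"
    using val cx b_b W ne by metis
  ultimately have by': "b y' = y" "b y = y'" using b_b W by auto
  \<comment> \<open>a double edge \<open>a\<close>, \<open>b\<close> also restricts the \<open>c\<close>-edge at \<open>v\<close>; its end \<open>y\<close> is taken by \<open>u\<close>\<close>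
  have "c v \<in> {y, b y}" using ba.double_ab[of y] W val by' ne by simp
  moreover have "c v \<noteq> y" using val c_c fixed_in assms by metis
  ultimately have cv: "c v = y'" "c y' = v" using by' c_c fixed_in by auto
  have "b w \<in> {x, c x}" using cab.double_ab[of x] W val cx ne by simp
  moreover have "b w \<noteq> x" using val b_b fixed_in assms by metis
  ultimately have bw: "b w = x'" "b x' = w" using cx b_b fixed_in by auto
  have dist: "distinct [u, v, w, x, x', y, y']"
    using assms(1-3) ne fixed val cx by' cv bw by (simp, smt (verit))
  have sub: "{u, v, w, x, x', y, y'} \<subseteq> W" using W fixed_in by auto
  have "card {u, v, w, x, x', y, y'} = 7" using dist by auto
  then show "card W \<noteq> 5" using card_mono[OF finite sub] by auto
  show "card W \<noteq> 7"
  proof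
    assume "card W = 7"
    then have all: "{u, v, w, x, x', y, y'} = W"
      using \<open>card {u, v, w, x, x', y, y'} = 7\<close> by (intro card_subset_eq[OF finite sub]) simp
    have "a v \<notin> {u, v, x, x', y, y'}"
      using dist fixed val a_eq[of v] a_fixed[of v] fixed_in W by auto
    then have av: "a v = w" using all closed fixed_in by blast
    then have "c (b w) \<in> {v, w}" using ba.path_from_fixed assms by simp
    then show False using bw cx dist by auto
  qed
qed

text \<open>
  The fixed points \<open>u\<close> and \<open>v\<close> lie on one triangle \<open>u\<close>, \<open>v\<close>, \<open>x\<close>. If the third vertex \<open>x\<close> is \<open>w\<close>, then the
  three singletons and the three edges of the triangle have the same union. Otherwise \<open>w\<close> has a
  triangle \<open>w\<close>, \<open>r\<close>, \<open>s\<close> of its own, the \<open>c\<close>-edge at \<open>x\<close> leads to a seventh point \<open>z\<close>, and \<open>a z = s\<close> is the only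
  possibility left.
\<close>

lemma shared_triangle_card:
  assumes "u \<noteq> v" "u \<noteq> w" "v \<noteq> w"
    and tri: "a (b u) = c u" "c (a w) = b w" and shared: "v = c u"
  shows "card W \<noteq> 5" "card W \<noteq> 7"
proof -
  define x where "x = b u"
  have x: "x \<in> W" using fixed_in closed by (auto simp: x_def)
  have fixed: "a u = u" "b v = v" "c w = w" using fixed_in a_fixed b_fixed c_fixed by auto
  have val: "b u = x" "b x = u" "a x = v" "a v = x" "c u = v" "c v = u"
  proof -
    show "b u = x" "a x = v" "c u = v" using tri shared by (simp_all add: x_def)
    then show "b x = u" "a v = x" "c v = u" using a_a[OF x] b_b c_c fixed_in by metis+
  qed
  have nx: "x \<noteq> u" "x \<noteq> v" using val fixed assms by metis+
  have "w \<noteq> x"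
  proof
    assume "w = x"
    then have cx: "c x = x" using fixed by simp
    have "{u, a u} \<union> {v, b v} \<union> {w, c w} = {v, a v} \<union> {u, b u} \<union> {u, c u}"
      unfolding fixed val cx \<open>w = x\<close> by blast
    from sep[OF fixed_in fixed_in(2,1,1) this] show False
      using assms(1-3) nx unfolding fixed val cx \<open>w = x\<close> by auto
  qed
  define z where "z = c x"
  define r where "r = a w"
  define s where "s = b w"
  have W: "z \<in> W" "r \<in> W" "s \<in> W" using fixed_in closed x by (auto simp: z_def r_def s_def)
  have val': "c x = z" "c z = x" "a w = r" "a r = w" "b w = s" "b s = w" "c r = s" "c s = r"
  proof -
    show "c x = z" "a w = r" "b w = s" "c r = s" using tri by (simp_all add: z_def r_def s_def)
    then show "c z = x" "a r = w" "b s = w" "c s = r" using inv x fixed_in W by metis+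
  qed
  have "r \<noteq> w" "s \<noteq> w" "z \<noteq> x"
    using a_moves[of w] b_moves[of w] c_moves[OF x] fixed_in assms(1-3) \<open>w \<noteq> x\<close>
    by (auto simp: r_def s_def z_def)
  moreover from this have "r \<noteq> s" using c_moves[OF W(2)] val' by metis
  ultimately have dist: "distinct [u, v, w, x, z, r, s]"
    using assms(1-3) nx \<open>w \<noteq> x\<close> fixed val val' by (simp, smt (verit))
  have sub: "{u, v, w, x, z, r, s} \<subseteq> W" using W x fixed_in by auto
  have "card {u, v, w, x, z, r, s} = 7" using dist by auto
  then show "card W \<noteq> 5" using card_mono[OF finite sub] by auto
  show "card W \<noteq> 7"
  proof
    assume "card W = 7"
    then have all: "{u, v, w, x, z, r, s} = W"
      using \<open>card {u, v, w, x, z, r, s} = 7\<close> by (intro card_subset_eq[OF finite sub]) simp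
    have "a z \<notin> {u, v, w, x, z, r}"
      using dist fixed(1) val(3,4) val'(3,4) a_a[OF W(1)] a_moves[OF W(1)] by auto
    then have az: "a z = s" using all closed W by blast
    \<comment> \<open>both sides are \<open>{u, w, s, x, z}\<close>: first \<open>{u}\<close>, \<open>{w, s}\<close>, \<open>{x, z}\<close>, then \<open>{z, s}\<close>, \<open>{u, x}\<close>, \<open>{w}\<close>\<close>
    have "{u, a u} \<union> {w, b w} \<union> {x, c x} = {z, a z} \<union> {u, b u} \<union> {w, c w}"
      unfolding fixed val val' az by blast
    from sep[OF fixed_in(1,3) x W(1) fixed_in(1,3) this] show False
      using dist unfolding fixed val val' az by auto
  qed
qed

text \<open>
  The triangles at \<open>u\<close> and \<open>v\<close>, together with \<open>w\<close>, take up seven points, so \<open>w\<close> finds no free points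
  for its own triangle.
\<close>

lemma disjoint_triangles_card:
  assumes "u \<noteq> v" "u \<noteq> w" "v \<noteq> w"
    and tri: "a (b u) = c u" "b (a v) = c v" "c (a w) = b w"
    and ns: "v \<noteq> c u" "w \<noteq> b u" "w \<noteq> a v"
  shows "card W \<noteq> 5" "card W \<noteq> 7"
proof -
  define x where "x = b u"
  define y where "y = c u"
  define p where "p = a v"
  define q where "q = c v"
  have W: "x \<in> W" "y \<in> W" "p \<in> W" "q \<in> W"
    using fixed_in closed by (auto simp: x_def y_def p_def q_def)
  have fixed: "a u = u" "b v = v" "c w = w" using fixed_in a_fixed b_fixed c_fixed by auto
  have val: "b u = x" "b x = u" "c u = y" "c y = u" "a x = y" "a y = x"
     "a v = p" "a p = v" "c v = q" "c q = v" "b p = q" "b q = p"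
  proof -
    show "b u = x" "c u = y" "a x = y" "a v = p" "c v = q" "b p = q"
      using tri by (simp_all add: x_def y_def p_def q_def)
    then show "b x = u" "c y = u" "a y = x" "a p = v" "c q = v" "b q = p"
      using inv fixed_in W by metis+
  qed
  have "x \<noteq> u" "y \<noteq> u" "p \<noteq> v" "q \<noteq> v"
    using a_moves[of v] b_moves[of u] c_moves[of u] c_moves[of v] fixed_in assms(1-3)
    by (auto simp: x_def y_def p_def q_def dest: sym)
  moreover from this have "x \<noteq> y" "p \<noteq> q"
    using a_moves[OF W(1)] b_moves[OF W(3)] val by metis+
  ultimately have dist: "distinct [u, v, w, x, y, p, q]"
    using assms(1-3) ns fixed val by (simp, smt (verit))
  have sub: "{u, v, w, x, y, p, q} \<subseteq> W" using W fixed_in by auto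
  have "card {u, v, w, x, y, p, q} = 7" using dist by auto
  then show "card W \<noteq> 5" using card_mono[OF finite sub] by auto
  show "card W \<noteq> 7"
  proof
    assume "card W = 7"
    then have all: "{u, v, w, x, y, p, q} = W"
      using \<open>card {u, v, w, x, y, p, q} = 7\<close> by (intro card_subset_eq[OF finite sub]) simp
    \<comment> \<open>the \<open>a\<close>-edge at \<open>w\<close> leads to \<open>q\<close>, but there the \<open>c\<close>-edge to \<open>v\<close> prevents a triangle with \<open>w\<close>\<close>
    have "a w \<notin> {u, v, w, x, y, p}"
      using dist fixed(1) val(5-8) a_a[OF fixed_in(3)] a_moves[OF fixed_in(3)] by auto
    then have "a w = q" using all closed fixed_in by blast
    then have "b w = v" using tri val by simp
    then show False using fixed b_b fixed_in assms by metis
  qed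
qed

lemma card_neq: "card W \<noteq> 5" "card W \<noteq> 7"
proof -
  interpret ac: separating_involutions W a c b u w v by (rule swap_bc)
  interpret ba: separating_involutions W b a c v u w by (rule swap_ab)
  interpret bca: separating_involutions W b c a v w u by (rule rotate)
  interpret cab: separating_involutions W c a b w u v by (rule bca.rotate)
  have "card W \<noteq> 5 \<and> card W \<noteq> 7"
  proof (cases "u = v \<or> u = w \<or> v = w")
    case True
    then have "u = v" "u = w"
      using two_fixed_points_equal ac.two_fixed_points_equal bca.two_fixed_points_equal by metis+
    then show ?thesis using common_fixed_point_card by blast
  next
    case False
    then have ne: "u \<noteq> v" "u \<noteq> w" "v \<noteq> w" "v \<noteq> u" "w \<noteq> u" "w \<noteq> v" by auto
    have "c (a (b u)) \<in> {u, b u}" "c (b (a v)) \<in> {v, a v}" "b (c (a w)) \<in> {w, a w}"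
      using path_from_fixed ba.path_from_fixed cab.path_from_fixed ne a_fixed b_fixed fixed_in by metis+
    then consider "c (a (b u)) = b u" | "c (b (a v)) = a v" | "b (c (a w)) = a w"
      | "c (a (b u)) = u" "c (b (a v)) = v" "b (c (a w)) = w" by blast
    then show ?thesis
    proof cases
      case 1
      then show ?thesis using two_doubles_card ne by blast
    next
      case 2
      then show ?thesis using ba.two_doubles_card ne by blast
    next
      case 3
      then show ?thesis using cab.two_doubles_card ne by blast
    next
      case 4
      then have tri: "a (b u) = c u" "b (a v) = c v" "c (a w) = b w"
        using c_eq[of "a (b u)" u] c_eq[of "b (a v)" v] b_eq[of "c (a w)" w] closed fixed_in by auto
      then have tri': "a (c u) = b u" "b (c v) = a v" "c (b w) = a w"
        using inv closed fixed_in by metis+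
      show ?thesis
      proof (cases "v = c u \<or> w = b u \<or> w = a v")
        case True
        then show ?thesis
          using shared_triangle_card ac.shared_triangle_card bca.shared_triangle_card ne tri tri' by metis
      next
        case False
        then show ?thesis using disjoint_triangles_card ne tri by blast
      qed
    qed
  qed
  then show "card W \<noteq> 5" "card W \<noteq> 7" by blast+
qed

end

section \<open>Resolving sets as triples of partitions\<close>

text \<open>
  The functions \<open>f\<close>, \<open>g\<close> and \<open>h\<close> are the three coordinates. Keeping them abstract makes the situation symmetric, so
  that facts about the first partition carry over to the others.
\<close>

locale separating_labels =
  fixes W :: "'a set" and n :: nat and f g h :: "'a \<Rightarrow> nat"
  assumes finite: "finite W" and n: "n \<ge> 3"
    and f_range: "x \<in> W \<Longrightarrow> f x \<in> {1..n}" and g_range: "x \<in> W \<Longrightarrow> g x \<in> {1..n}"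
    and h_range: "x \<in> W \<Longrightarrow> h x \<in> {1..n}"
    and sep: "\<lbrakk>i \<in> {1..n}; j \<in> {1..n}; k \<in> {1..n}; i' \<in> {1..n}; j' \<in> {1..n}; k' \<in> {1..n};
        \<forall>x\<in>W. (f x = i \<or> g x = j \<or> h x = k) \<longleftrightarrow> (f x = i' \<or> g x = j' \<or> h x = k')\<rbrakk> \<Longrightarrow>
        i = i' \<and> j = j' \<and> k = k' \<or> (\<exists>x\<in>W. f x = i \<and> g x = j \<and> h x = k) \<or>
        (\<exists>x\<in>W. f x = i' \<and> g x = j' \<and> h x = k')"
begin

lemma swap_fg: "separating_labels W n g f h"
proof (unfold_locales; (fact finite n f_range g_range h_range)?)
  fix i j k i' j' k'
  assume r: "i \<in> {1..n}" "j \<in> {1..n}" "k \<in> {1..n}" "i' \<in> {1..n}" "j' \<in> {1..n}" "k' \<in> {1..n}"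
    and eq: "\<forall>x\<in>W. (g x = i \<or> f x = j \<or> h x = k) \<longleftrightarrow> (g x = i' \<or> f x = j' \<or> h x = k')"
  have "\<forall>x\<in>W. (f x = j \<or> g x = i \<or> h x = k) \<longleftrightarrow> (f x = j' \<or> g x = i' \<or> h x = k')"
    using eq by (simp only: disj_left_commute)
  from sep[OF r(2,1,3,5,4,6) this]
  show "i = i' \<and> j = j' \<and> k = k' \<or> (\<exists>x\<in>W. g x = i \<and> f x = j \<and> h x = k) \<or>
        (\<exists>x\<in>W. g x = i' \<and> f x = j' \<and> h x = k')"
    by blast
qed

lemma swap_fh: "separating_labels W n h g f"
proof (unfold_locales; (fact finite n f_range g_range h_range)?)
  fix i j k i' j' k'
  assume r: "i \<in> {1..n}" "j \<in> {1..n}" "k \<in> {1..n}" "i' \<in> {1..n}" "j' \<in> {1..n}" "k' \<in> {1..n}"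
    and eq: "\<forall>x\<in>W. (h x = i \<or> g x = j \<or> f x = k) \<longleftrightarrow> (h x = i' \<or> g x = j' \<or> f x = k')"
  have "\<forall>x\<in>W. (f x = k \<or> g x = j \<or> h x = i) \<longleftrightarrow> (f x = k' \<or> g x = j' \<or> h x = i')"
    using eq by (simp only: disj_ac)
  from sep[OF r(3,2,1,6,5,4) this]
  show "i = i' \<and> j = j' \<and> k = k' \<or> (\<exists>x\<in>W. h x = i \<and> g x = j \<and> f x = k) \<or>
        (\<exists>x\<in>W. h x = i' \<and> g x = j' \<and> f x = k')"
    by blast
qed

text \<open>
  At most two points can always be covered by one class of \<open>g\<close> and one of \<open>h\<close> in such a way that no
  point is in both: each class takes one point, or one class takes both and the other
  one avoids them. The last condition guarantees that the two vertices in question are not themselves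
  in the resolving set.
\<close>

lemma two_classes:
  assumes "i \<in> {1..n}" "i' \<in> {1..n}" "i \<noteq> i'"
  shows "3 \<le> card {x \<in> W. f x = i} + card {x \<in> W. f x = i'}"
proof (rule ccontr)
  define S where "S = {x \<in> W. f x = i} \<union> {x \<in> W. f x = i'}"
  assume "\<not> 3 \<le> card {x \<in> W. f x = i} + card {x \<in> W. f x = i'}"
  then have "card S \<le> 2"
    unfolding S_def using card_Un_le[of "{x \<in> W. f x = i}" "{x \<in> W. f x = i'}"] by linarith
  moreover have S: "S \<subseteq> W" "finite S" using finite by (auto simp: S_def)
  ultimately consider "S = {}" | x where "S = {x}" | x y where "S = {x, y}" "x \<noteq> y"
    by (metis One_nat_def Suc_1 card_0_eq card_1_singletonE card_2_iff le_Suc_eq le_zero_eq)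
  then obtain j k where jk: "j \<in> {1..n}" "k \<in> {1..n}" and cover: "\<forall>x\<in>S. g x = j \<or> h x = k"
    and star: "\<not> (\<exists>x\<in>S. g x = j \<and> h x = k)"
  proof cases
    case 1
    then show ?thesis using that[of 1 1] n by simp
  next
    case (2 x)
    obtain k where "k \<in> {1..n}" "k \<noteq> h x" using avoid_two[OF n] by metis
    then show ?thesis using that[of "g x" k] 2 S g_range by auto
  next
    case (3 x y)
    have W: "x \<in> W" "y \<in> W" using 3 S by auto
    consider "g x = g y" | "h x = h y" | "g x \<noteq> g y" "h x \<noteq> h y" by blast
    then show ?thesis
    proof cases
      case 1
      obtain k where "k \<in> {1..n}" "k \<noteq> h x" "k \<noteq> h y" using avoid_two[OF n] by metis
      then show ?thesis using that[of "g x" k] 3 1 W g_range by auto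
    next
      case 2
      obtain j where "j \<in> {1..n}" "j \<noteq> g x" "j \<noteq> g y" using avoid_two[OF n] by metis
      then show ?thesis using that[of j "h x"] 3 2 W h_range by auto
    next
      case xy: 3
      then show ?thesis using that[of "g x" "h y"] 3 W g_range h_range by auto
    qed
  qed
  have "\<forall>x\<in>W. (f x = i \<or> g x = j \<or> h x = k) \<longleftrightarrow> (f x = i' \<or> g x = j \<or> h x = k)"
    using cover by (auto simp: S_def)
  from sep[OF assms(1) jk assms(2) jk this] show False
    using star assms(3) by (auto simp: S_def)
qed

lemma card_classes: "card W = (\<Sum>i=1..n. card {x \<in> W. f x = i})"
proof -
  have "(\<Sum>i=1..n. \<Sum>x\<in>{x \<in> W. f x = i}. 1) = (\<Sum>x\<in>W. 1 :: nat)"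
    using f_range by (intro sum.group finite) auto
  then show ?thesis by simp
qed

text \<open>
  If some class has at most one point, \<open>two_classes\<close> bounds all others from below: by 3 next to an empty
  class, which gives \<open>3 * (n - 1) \<ge> 2 * n\<close> points, and by 2 next to a singleton.
\<close>

lemma card_ge: "2 * n - 1 \<le> card W"
  and one_singleton_class: "card W = 2 * n - 1 \<Longrightarrow> \<exists>i\<in>{1..n}. card {x \<in> W. f x = i} = 1 \<and>
    (\<forall>i'\<in>{1..n} - {i}. card {x \<in> W. f x = i'} = 2)"
proof -
  let ?c = "\<lambda>i. card {x \<in> W. f x = i}"
  have "2 * n - 1 \<le> card W \<and> (card W = 2 * n - 1 \<longrightarrow> (\<exists>i\<in>{1..n}. ?c i = 1 \<and> (\<forall>i'\<in>{1..n} - {i}. ?c i' = 2)))"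
  proof (cases "\<exists>i\<in>{1..n}. ?c i \<le> 1")
    case False
    then have "(\<Sum>i=1..n. 2) \<le> (\<Sum>i=1..n. ?c i)"
      by (intro sum_mono) force
    then have "2 * n \<le> card W" using card_classes by simp
    then show ?thesis using n by (intro conjI impI) linarith+
  next
    case True
    then obtain i where i: "i \<in> {1..n}" "?c i \<le> 1" by blast
    have others: "3 - ?c i \<le> ?c i'" if "i' \<in> {1..n} - {i}" for i'
      using two_classes[of i i'] that i by auto
    have split: "card W = ?c i + (\<Sum>i'\<in>{1..n} - {i}. ?c i')"
      unfolding card_classes using i by (intro sum.remove) auto
    have "(\<Sum>i'\<in>{1..n} - {i}. 3 - ?c i) \<le> (\<Sum>i'\<in>{1..n} - {i}. ?c i')"
      by (intro sum_mono others)
    then have ge: "?c i + (n - 1) * (3 - ?c i) \<le> card W"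
      using split i by (simp add: mult.commute)
    consider "?c i = 0" | "?c i = 1" using i by linarith
    then show ?thesis
    proof cases
      case 1
      then have "(n - 1) * 3 \<le> card W" using ge by simp
      then show ?thesis using n by (intro conjI impI) linarith+
    next
      case 2
      have "?c i' = 2" if eq: "card W = 2 * n - 1" and i': "i' \<in> {1..n} - {i}" for i'
      proof -
        have "(\<Sum>i'\<in>{1..n} - {i}. 2) = (\<Sum>i'\<in>{1..n} - {i}. ?c i')"
        proof -
          have "(\<Sum>i'\<in>{1..n} - {i}. 2) = 2 * (n - 1)" using i by simp
          also have "\<dots> = (\<Sum>i'\<in>{1..n} - {i}. ?c i')" using split eq 2 n by linarith
          finally show ?thesis .
        qed
        from sum_mono_inv[OF this _ i'] show ?thesis using others 2 by simp
      qed
      then have "card W = 2 * n - 1 \<longrightarrow> (\<exists>i\<in>{1..n}. ?c i = 1 \<and> (\<forall>i'\<in>{1..n} - {i}. ?c i' = 2))"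
        using 2 i(1) by (intro impI bexI[of _ i] conjI ballI) simp_all
      moreover have "2 * n - 1 \<le> card W" using ge 2 n by simp
      ultimately show ?thesis by blast
    qed
  qed
  then show "2 * n - 1 \<le> card W"
    and "card W = 2 * n - 1 \<Longrightarrow> \<exists>i\<in>{1..n}. ?c i = 1 \<and> (\<forall>i'\<in>{1..n} - {i}. ?c i' = 2)"
    by blast+
qed

lemma partner_involution:
  assumes "card W = 2 * n - 1"
  shows "\<exists>a u. u \<in> W \<and> (\<forall>x\<in>W. a x \<in> W) \<and> (\<forall>x\<in>W. a (a x) = x) \<and> (\<forall>x\<in>W. a x = x \<longleftrightarrow> x = u) \<and>
    (\<forall>x\<in>W. \<forall>y\<in>W. f y = f x \<longleftrightarrow> y \<in> {x, a x})"
proof -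
  define C where "C x = {y \<in> W. f y = f x}" for x
  obtain i where i: "i \<in> {1..n}" "card {x \<in> W. f x = i} = 1"
    "\<And>i'. i' \<in> {1..n} - {i} \<Longrightarrow> card {x \<in> W. f x = i'} = 2"
    using one_singleton_class[OF assms] by blast
  from i(2) obtain u where u: "{x \<in> W. f x = i} = {u}" by (rule card_1_singletonE)
  then have uW: "u \<in> W" "f u = i" by auto
  have card_C: "card (C x) = (if x = u then 1 else 2)" if "x \<in> W" for x
    using that i(2) i(3)[of "f x"] f_range[OF that] u uW by (auto simp: C_def)
  have "\<exists>y. C x = {x, y} \<and> (y = x \<longleftrightarrow> x = u)" if "x \<in> W" for x
  proof (cases "x = u")
    case True
    then show ?thesis using u uW by (intro exI[of _ u]) (auto simp: C_def)
  next
    case False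
    then have "card (C x) = 2" using card_C that by simp
    moreover have "x \<in> C x" using that by (simp add: C_def)
    ultimately obtain y where "C x = {x, y}" "x \<noteq> y"
      by (auto simp: card_2_iff doubleton_eq_iff insert_commute)
    then show ?thesis using False by blast
  qed
  then have "\<forall>x\<in>W. \<exists>y. C x = {x, y} \<and> (y = x \<longleftrightarrow> x = u)" by blast
  from bchoice[OF this] obtain a where a: "\<forall>x\<in>W. C x = {x, a x} \<and> (a x = x \<longleftrightarrow> x = u)" ..
  then have class_eq: "C x = {x, a x}" if "x \<in> W" for x using that by blast
  have a_W: "a x \<in> W" and f_a: "f (a x) = f x" if "x \<in> W" for x
    using class_eq[OF that] by (auto simp: C_def)
  have "a (a x) = x" if "x \<in> W" for x
  proof -
    have "{a x, a (a x)} = {x, a x}"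
      using class_eq[OF a_W[OF that]] class_eq[OF that] f_a[OF that] by (simp add: C_def)
    then show ?thesis by (auto simp: doubleton_eq_iff)
  qed
  moreover have "f y = f x \<longleftrightarrow> y \<in> {x, a x}" if "x \<in> W" "y \<in> W" for x y
    using class_eq[OF that(1)] that(2) unfolding C_def by blast
  ultimately show ?thesis using uW a a_W by (intro exI[of _ a] exI[of _ u] conjI ballI) simp_all
qed

lemma card_neq_if_small:
  assumes "n = 3 \<or> n = 4"
  shows "card W \<noteq> 2 * n - 1"
proof
  assume card: "card W = 2 * n - 1"
  interpret g: separating_labels W n g f h by (rule swap_fg)
  interpret h: separating_labels W n h g f by (rule swap_fh)
  obtain a u where a: "u \<in> W" "\<forall>x\<in>W. a x \<in> W" "\<forall>x\<in>W. a (a x) = x" "\<forall>x\<in>W. a x = x \<longleftrightarrow> x = u"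
    and f: "\<forall>x\<in>W. \<forall>y\<in>W. f y = f x \<longleftrightarrow> y \<in> {x, a x}"
    using partner_involution[OF card] by (elim exE conjE)
  obtain b v where b: "v \<in> W" "\<forall>x\<in>W. b x \<in> W" "\<forall>x\<in>W. b (b x) = x" "\<forall>x\<in>W. b x = x \<longleftrightarrow> x = v"
    and g: "\<forall>x\<in>W. \<forall>y\<in>W. g y = g x \<longleftrightarrow> y \<in> {x, b x}"
    using g.partner_involution[OF card] by (elim exE conjE)
  obtain c w where c: "w \<in> W" "\<forall>x\<in>W. c x \<in> W" "\<forall>x\<in>W. c (c x) = x" "\<forall>x\<in>W. c x = x \<longleftrightarrow> x = w"
    and h: "\<forall>x\<in>W. \<forall>y\<in>W. h y = h x \<longleftrightarrow> y \<in> {x, c x}"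
    using h.partner_involution[OF card] by (elim exE conjE)
  note f = f[rule_format] and g = g[rule_format] and h = h[rule_format]
  interpret inv: separating_involutions W a b c u v w
  proof (unfold_locales; (fact finite a(1) b(1) c(1) a(2-)[rule_format] b(2-)[rule_format] c(2-)[rule_format])?)
    fix p q r p' q' r'
    assume W: "p \<in> W" "q \<in> W" "r \<in> W" "p' \<in> W" "q' \<in> W" "r' \<in> W"
      and eq: "{p, a p} \<union> {q, b q} \<union> {r, c r} = {p', a p'} \<union> {q', b q'} \<union> {r', c r'}"
    have "(f x = f p \<or> g x = g q \<or> h x = h r) \<longleftrightarrow> (f x = f p' \<or> g x = g q' \<or> h x = h r')"
      if "x \<in> W" for x
    proof -
      have "x \<in> {p, a p} \<union> {q, b q} \<union> {r, c r} \<longleftrightarrow> x \<in> {p', a p'} \<union> {q', b q'} \<union> {r', c r'}"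
        by (simp only: eq)
      then show ?thesis unfolding Un_iff f[OF W(1) that, symmetric] g[OF W(2) that, symmetric]
        h[OF W(3) that, symmetric] f[OF W(4) that, symmetric] g[OF W(5) that, symmetric]
        h[OF W(6) that, symmetric] by (simp only: disj_assoc)
    qed
    then have "\<forall>x\<in>W. (f x = f p \<or> g x = g q \<or> h x = h r) \<longleftrightarrow> (f x = f p' \<or> g x = g q' \<or> h x = h r')"
      by blast
    from sep[OF f_range[OF W(1)] g_range[OF W(2)] h_range[OF W(3)] f_range[OF W(4)] g_range[OF W(5)]
        h_range[OF W(6)] this]
    consider "f p' = f p" "g q' = g q" "h r' = h r"
      | x where "x \<in> W" "f x = f p" "g x = g q" "h x = h r"
      | x where "x \<in> W" "f x = f p'" "g x = g q'" "h x = h r'"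
      by metis
    then show "p' \<in> {p, a p} \<and> q' \<in> {q, b q} \<and> r' \<in> {r, c r} \<or>
        {p, a p} \<inter> {q, b q} \<inter> {r, c r} \<noteq> {} \<or> {p', a p'} \<inter> {q', b q'} \<inter> {r', c r'} \<noteq> {}"
    proof cases
      case 1
      then show ?thesis
        unfolding f[OF W(1,4)] g[OF W(2,5)] h[OF W(3,6)] by (intro disjI1 conjI)
    next
      case 2
      then have "x \<in> {p, a p} \<inter> {q, b q} \<inter> {r, c r}"
        unfolding f[OF W(1) 2(1)] g[OF W(2) 2(1)] h[OF W(3) 2(1)] by (intro IntI)
      then show ?thesis by blast
    next
      case 3
      then have "x \<in> {p', a p'} \<inter> {q', b q'} \<inter> {r', c r'}"
        unfolding f[OF W(4) 3(1)] g[OF W(5) 3(1)] h[OF W(6) 3(1)] by (intro IntI)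
      then show ?thesis by blast
    qed
  qed
  show False using inv.card_neq card assms by auto
qed

end

lemma resolving_separating_labels:
  assumes n: "n \<ge> 3" and W: "pre_digraph.resolving_set (HG3 n n n) W"
  shows "separating_labels W n fst (fst \<circ> snd) (snd \<circ> snd)"
proof
  note resolving = W[unfolded resolving_set_HG3_iff[OF n]]
  note sub = resolving[THEN conjunct1] and sep = resolving[THEN conjunct2, rule_format]
  show "finite W" using sub by (rule finite_subset) simp
  show "n \<ge> 3" by (rule n)
  show "fst x \<in> {1..n}" "(fst \<circ> snd) x \<in> {1..n}" "(snd \<circ> snd) x \<in> {1..n}" if "x \<in> W" for x
    using subsetD[OF sub that] by (cases x; simp)+
  fix i j k i' j' k'
  assume range: "i \<in> {1..n}" "j \<in> {1..n}" "k \<in> {1..n}" "i' \<in> {1..n}" "j' \<in> {1..n}" "k' \<in> {1..n}"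
    and eq: "\<forall>x\<in>W. (fst x = i \<or> (fst \<circ> snd) x = j \<or> (snd \<circ> snd) x = k) \<longleftrightarrow>
      (fst x = i' \<or> (fst \<circ> snd) x = j' \<or> (snd \<circ> snd) x = k')"
  have "meets (i, j, k) x \<longleftrightarrow> meets (i', j', k') x" if "x \<in> W" for x
    using bspec[OF eq that] by (simp add: meets_def eq_commute)
  then have "\<not> separated W (i, j, k) (i', j', k')"
    by (simp add: separated_def)
  moreover have "(i, j, k) \<in> cube n" "(i', j', k') \<in> cube n" using range by simp_all
  ultimately have "(i, j, k) = (i', j', k') \<or> (i, j, k) \<in> W \<or> (i', j', k') \<in> W"
    using sep[of "(i, j, k)" "(i', j', k')"] by (metis Diff_iff)
  then show "i = i' \<and> j = j' \<and> k = k' \<or>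
      (\<exists>x\<in>W. fst x = i \<and> (fst \<circ> snd) x = j \<and> (snd \<circ> snd) x = k) \<or>
      (\<exists>x\<in>W. fst x = i' \<and> (fst \<circ> snd) x = j' \<and> (snd \<circ> snd) x = k')"
    by (elim disjE) force+
qed

section \<open>The metric dimension\<close>

theorem theorem4p6:
  fixes n :: nat
  assumes "n \<ge> 3"
  shows "pre_digraph.metric_dimension (HG3 n n n) = (if n \<in> {3, 4} then 2 * n else 2 * n - 1)"
  unfolding pre_digraph.metric_dimension_def
proof (rule Least_equality)
  show "\<exists>W. pre_digraph.resolving_set (HG3 n n n) W \<and> card W = (if n \<in> {3, 4} then 2 * n else 2 * n - 1)"
    by (rule ex_resolving[OF assms])
next
  fix k assume "\<exists>W. pre_digraph.resolving_set (HG3 n n n) W \<and> card W = k"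
  then obtain W where "pre_digraph.resolving_set (HG3 n n n) W" "card W = k" by blast
  then interpret separating_labels W n fst "fst \<circ> snd" "snd \<circ> snd"
    using resolving_separating_labels[OF assms] by blast
  show "(if n \<in> {3, 4} then 2 * n else 2 * n - 1) \<le> k"
    using card_ge card_neq_if_small \<open>card W = k\<close> by auto
qed

end
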